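(* Fix positive integers $k\leq n$. The operahedron lattice $\mathrm{MN}(\mathsf{Broom}_{k,n})$ is isomorphic to the subposet $\mathtt{s}^{-1}(\Delta_{\mathrm{Weak}(\mathfrak S_n)}(w_{\circ}(k,n)))$ of $\mathrm{Weak}(\mathfrak S_n)$.
   Context: A rooted plane tree is a rooted tree in which the children of each vertex are linearly ordered from left to right. For a rooted plane tree $\mathsf{T}$ with $n+1$ vertices and vertex set $\mathsf{V}$, view $\mathsf{V}$ as a poset $(\mathsf{V},\leq_\mathsf{T})$ in which the root is the unique minimum and each non-root vertex covers exactly its parent. Identify $\mathsf{V}$ with $\{0,\ldots,n\}$ so that $0,1,\ldots,n$ is the preorder traversal (root first, then subtrees of the root, recursively in preorder, left to right). A tube is a set of vertices inducing a connected subgraph; its root is its $\leq_\mathsf{T}$-minimum. A nesting is a collection $\mathcal N$ of tubes with $\mathsf{V}\in\mathcal N$, each tube of size $\geq 2$, any two tubes nested or disjoint; a maximal nesting has exactly $n$ tubes; $\mathrm{MN}(\mathsf{T})$ is the set of maximal nestings. For $\mathcal N,\mathcal N'\in\mathrm{MN}(\mathsf{T})$ with $\tau\in\mathcal N\setminus\mathcal N'$, $\tau'\in\mathcal N'\setminus\mathcal N$ and $\mathcal N\setminus\{\tau\}=\mathcal N'\setminus\{\tau'\}$, declare $\mathcal N\lessdot\mathcal N'$ if some (equivalently every) element of $\tau\setminus\tau'$ is less than some (equivalently every) element of $\tau'\setminus\tau$ in $\mathbb Z$; $\mathrm{MN}(\mathsf{T})$ is ordered by the reflexive–transitive closure of these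 relations. The broom $\mathsf{Broom}_{k,n}$ is the rooted plane tree with $n+1$ vertices and $k$ leaves obtained by identifying the top vertex of a chain (path rooted at an endpoint) with $n-k+1$ vertices with the root of a claw (a root with $k$ children) with $k+1$ vertices; in preorder labels, vertex $i$ is the child of $i-1$ for $1\leq i\leq n-k$, and vertices $n-k+1,\ldots,n$ are the children of $n-k$. $\mathfrak S_n$ is the symmetric group on $[n]=\{1,\ldots,n\}$, permutations written in one-line notation $w(1)\cdots w(n)$. An inversion of $w$ is a pair $(i,j)$ with $1\leq i<j\leq n$ and $w^{-1}(j)<w^{-1}(i)$; $\mathrm{Weak}(\mathfrak S_n)$ is the order $w\leq w'$ iff $\mathrm{Inv}(w)\subseteq\mathrm{Inv}(w')$. For $w$, $\Delta_{\mathrm{Weak}(\mathfrak S_n)}(w)=\{u: u\leq w\}$. Let $w_\circ(k,n)=k(k-1)\cdots 1(k+1)(k+2)\cdots n$. West's stack-sorting map $\mathtt{s}$ acts on words with distinct positive integer letters: $\mathtt{s}(\epsilon)=\epsilon$ for the empty word, and if $\sigma=\mathsf{L}m\mathsf{R}$ where $m$ is the largest letter, then $\mathtt{s}(\sigma)=\mathtt{s}(\mathsf{L})\mathtt{s}(\mathsf{R})m$; restricted to $\mathfrak S_n$ it is a map $\mathfrak S_n\to\mathfrak S_n$. *)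

theory Defs
  imports "HOL-Combinatorics.Permutations"
begin

section \<open>Rooted plane trees\<close>

datatype plane_tree = Node "plane_tree list"

fun num_vertices :: "plane_tree \<Rightarrow> nat" where
  "num_vertices (Node ts) = Suc (sum_list (map num_vertices ts))"

text \<open>
  The vertices of \<open>t\<close> are identified with \<open>{0..<num_vertices t}\<close> by preorder.
  Below, \<open>tree_edges r t\<close> is the set of pairs (parent, child) when the preorder labels of \<open>t\<close>
  are shifted so that its root is \<open>r\<close>, and \<open>forest_edges r c ts\<close> collects the edges obtained by
  attaching the trees \<open>ts\<close> to a vertex \<open>r\<close>, their labels being consecutive and starting at \<open>c\<close>.
\<close>

fun tree_edges :: "nat \<Rightarrow> plane_tree \<Rightarrow> (nat \<times> nat) set"
  and forest_edges :: "nat \<Rightarrow> nat \<Rightarrow> plane_tree list \<Rightarrow> (nat \<times> nat) set" where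
  "tree_edges r (Node ts) = forest_edges r (Suc r) ts"
| "forest_edges r c [] = {}"
| "forest_edges r c (t # ts) =
     insert (r, c) (tree_edges c t \<union> forest_edges r (c + num_vertices t) ts)"

definition vertices :: "plane_tree \<Rightarrow> nat set" where
  "vertices t = {0..<num_vertices t}"

definition parent_child :: "plane_tree \<Rightarrow> (nat \<times> nat) set" where
  "parent_child t = tree_edges 0 t"

section \<open>Maximal nestings\<close>

definition tube :: "plane_tree \<Rightarrow> nat set \<Rightarrow> bool" where
  "tube t A \<longleftrightarrow> A \<noteq> {} \<and> A \<subseteq> vertices t \<and>
     (\<forall>x\<in>A. \<forall>y\<in>A. (x, y) \<in> (Restr (parent_child t \<union> (parent_child t)\<inverse>) A)\<^sup>*)"

definition nesting :: "plane_tree \<Rightarrow> nat set set \<Rightarrow> bool" where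
  "nesting t N \<longleftrightarrow> vertices t \<in> N \<and>
     (\<forall>A\<in>N. tube t A \<and> card A \<ge> 2) \<and>
     (\<forall>A\<in>N. \<forall>B\<in>N. A \<subseteq> B \<or> B \<subseteq> A \<or> A \<inter> B = {})"

definition MN :: "plane_tree \<Rightarrow> nat set set set" where
  "MN t = {N. nesting t N \<and> (\<forall>N'. nesting t N' \<and> N \<subseteq> N' \<longrightarrow> N' = N)}"

definition MN_less :: "plane_tree \<Rightarrow> nat set set \<Rightarrow> nat set set \<Rightarrow> bool" where
  "MN_less t N N' \<longleftrightarrow> N \<in> MN t \<and> N' \<in> MN t \<and>
     (\<exists>A\<in>N - N'. \<exists>A'\<in>N' - N. N - {A} = N' - {A'} \<and>
        (\<exists>a\<in>A - A'. \<exists>a'\<in>A' - A. a < a'))"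

definition MN_le :: "plane_tree \<Rightarrow> nat set set \<Rightarrow> nat set set \<Rightarrow> bool" where
  "MN_le t = (MN_less t)\<^sup>*\<^sup>*"

section \<open>Brooms\<close>

definition claw :: "nat \<Rightarrow> plane_tree" where
  "claw k = Node (replicate k (Node []))"

text \<open>
  Gluing the claw to the top of a chain with \<open>n - k + 1\<close> vertices puts \<open>n - k\<close> further vertices,
  each having a single child, below the root of the claw.
\<close>

definition broom :: "nat \<Rightarrow> nat \<Rightarrow> plane_tree" where
  "broom k n = ((\<lambda>t. Node [t]) ^^ (n - k)) (claw k)"

lemma num_vertices_chain:
  "num_vertices (((\<lambda>t. Node [t]) ^^ m) t) = m + num_vertices t"
  by (induction m) auto

lemma num_vertices_broom: "k \<le> n \<Longrightarrow> num_vertices (broom k n) = Suc n"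
  by (simp add: broom_def num_vertices_chain claw_def sum_list_replicate)

lemma vertices_broom: "k \<le> n \<Longrightarrow> vertices (broom k n) = {0..n}"
  by (auto simp: vertices_def num_vertices_broom)

lemma tree_edges_chain:
  "tree_edges r (((\<lambda>t. Node [t]) ^^ m) t) =
     {(i - 1, i) |i. r < i \<and> i \<le> r + m} \<union> tree_edges (r + m) t"
proof (induction m arbitrary: r)
  case (Suc m)
  have "{(i - 1, i) |i. r < i \<and> i \<le> r + Suc m} =
        insert (r, Suc r) {(i - 1, i) |i. Suc r < i \<and> i \<le> Suc r + m}"
    by (auto simp: less_Suc_eq_le Suc_le_eq)
  with Suc show ?case by auto
qed auto

lemma forest_edges_leaves:
  "forest_edges r c (replicate k (Node [])) = {(r, i) |i. c \<le> i \<and> i < c + k}"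
  by (induction k arbitrary: c) auto

lemma parent_child_broom:
  assumes "k \<le> n"
  shows "parent_child (broom k n) =
    {(i - 1, i) |i. 1 \<le> i \<and> i \<le> n - k} \<union> {(n - k, i) |i. n - k + 1 \<le> i \<and> i \<le> n}"
  using assms
  by (auto simp: parent_child_def broom_def tree_edges_chain claw_def forest_edges_leaves)

section \<open>The weak order\<close>

text \<open>Elements of the symmetric group are functions \<open>w\<close> with \<open>w permutes {1..n}\<close>.\<close>

definition Inversions :: "nat \<Rightarrow> (nat \<Rightarrow> nat) \<Rightarrow> (nat \<times> nat) set" where
  "Inversions n w = {(i, j). 1 \<le> i \<and> i < j \<and> j \<le> n \<and> inv w j < inv w i}"

definition weak_le :: "nat \<Rightarrow> (nat \<Rightarrow> nat) \<Rightarrow> (nat \<Rightarrow> nat) \<Rightarrow> bool" where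
  "weak_le n w w' \<longleftrightarrow> Inversions n w \<subseteq> Inversions n w'"

definition weak_ideal :: "nat \<Rightarrow> (nat \<Rightarrow> nat) \<Rightarrow> (nat \<Rightarrow> nat) set" where
  "weak_ideal n w = {u. u permutes {1..n} \<and> weak_le n u w}"

definition w_circ :: "nat \<Rightarrow> nat \<Rightarrow> nat \<Rightarrow> nat" where
  "w_circ k n = (\<lambda>i. if 1 \<le> i \<and> i \<le> k then k + 1 - i else i)"

definition one_line :: "nat \<Rightarrow> (nat \<Rightarrow> nat) \<Rightarrow> nat list" where
  "one_line n w = map w [1..<Suc n]"

lemma one_line_w_circ:
  assumes "k \<le> n"
  shows "one_line n (w_circ k n) = rev [1..<Suc k] @ [Suc k..<Suc n]"
  by (rule nth_equalityI)
     (use assms in \<open>auto simp: one_line_def w_circ_def nth_append rev_nth simp del: upt_Suc\<close>)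

section \<open>West's stack-sorting map\<close>

function stack_sort :: "nat list \<Rightarrow> nat list" where
  "stack_sort xs = (if xs = [] then [] else
     let m = Max (set xs)
     in stack_sort (takeWhile (\<lambda>x. x \<noteq> m) xs) @
        stack_sort (tl (dropWhile (\<lambda>x. x \<noteq> m) xs)) @ [m])"
  by pat_completeness auto
termination
proof (relation "measure length", goal_cases)
  case (2 xs m)
  then have "m \<in> set xs" by simp
  then have "length (dropWhile (\<lambda>x. x \<noteq> m) xs) > 0"
    by (simp add: dropWhile_eq_Nil_conv)
  moreover have "length xs =
      length (takeWhile (\<lambda>x. x \<noteq> m) xs) + length (dropWhile (\<lambda>x. x \<noteq> m) xs)"
    by (metis length_append takeWhile_dropWhile_id)
  ultimately show ?case
    unfolding in_measure by linarith
next
  case (3 xs m)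
  then show ?case
    using length_dropWhile_le[of "\<lambda>x. x \<noteq> m" xs] by (cases xs) auto
qed simp

declare stack_sort.simps [simp del]

lemma stack_sort_Nil: "stack_sort [] = []"
  by (simp add: stack_sort.simps)

lemma stack_sort_rec:
  assumes "\<forall>x\<in>set L \<union> set R. x < m"
  shows "stack_sort (L @ m # R) = stack_sort L @ stack_sort R @ [m]"
proof -
  have "Max (set (L @ m # R)) = m"
    using assms by (intro Max_eqI) (auto intro: less_imp_le)
  moreover have "\<forall>x\<in>set L. x \<noteq> m"
    using assms by auto
  moreover from this have "takeWhile (\<lambda>x. x \<noteq> m) (L @ m # R) = L"
    "dropWhile (\<lambda>x. x \<noteq> m) (L @ m # R) = m # R"
    by (simp_all add: takeWhile_append2 dropWhile_append2)
  ultimately show ?thesis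
    by (subst stack_sort.simps) (simp add: Let_def)
qed

lemma mset_stack_sort: "mset (stack_sort xs) = mset xs"
proof (induction xs rule: stack_sort.induct)
  case (1 xs)
  show ?case
  proof (cases "xs = []")
    case False
    define m where "m = Max (set xs)"
    let ?L = "takeWhile (\<lambda>x. x \<noteq> m) xs" and ?D = "dropWhile (\<lambda>x. x \<noteq> m) xs"
    have "m \<in> set xs" using False by (simp add: m_def)
    then have "?D \<noteq> []"
      by (simp add: dropWhile_eq_Nil_conv)
    moreover from this have "hd ?D = m"
      using hd_dropWhile by blast
    ultimately have D: "?D = m # tl ?D"
      by (metis list.collapse)
    have "mset xs = mset ?L + mset ?D"
      by (metis mset_append takeWhile_dropWhile_id)
    also have "mset ?D = add_mset m (mset (tl ?D))"
      by (subst D) simp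
    finally have "mset xs = mset ?L + add_mset m (mset (tl ?D))" .
    moreover have "mset (stack_sort ?L) = mset ?L" "mset (stack_sort (tl ?D)) = mset (tl ?D)"
      using 1 False by (simp_all add: m_def)
    moreover have "stack_sort xs = stack_sort ?L @ stack_sort (tl ?D) @ [m]"
      using False by (subst stack_sort.simps) (simp add: m_def Let_def)
    ultimately show ?thesis
      by simp
  qed (simp add: stack_sort_Nil)
qed

text \<open>The map induced by \<open>stack_sort\<close> on permutations via one-line notation.\<close>

definition stack_sort_perm :: "nat \<Rightarrow> (nat \<Rightarrow> nat) \<Rightarrow> (nat \<Rightarrow> nat)" where
  "stack_sort_perm n w =
     (\<lambda>i. if 1 \<le> i \<and> i \<le> n then stack_sort (one_line n w) ! (i - 1) else i)"

lemma length_stack_sort_one_line: "length (stack_sort (one_line n w)) = n"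
  using arg_cong[OF mset_stack_sort[of "one_line n w"], of size] by (simp add: one_line_def)

lemma one_line_stack_sort_perm:
  "one_line n (stack_sort_perm n w) = stack_sort (one_line n w)"
  by (rule nth_equalityI)
     (auto simp: length_stack_sort_one_line, auto simp: one_line_def stack_sort_perm_def simp del: upt_Suc)

lemma stack_sort_perm_permutes:
  assumes "w permutes {1..n}"
  shows "stack_sort_perm n w permutes {1..n}"
proof (rule bij_imp_permutes)
  let ?v = "stack_sort_perm n w"
  have *: "set [1..<Suc n] = {1..n}" by auto
  have "mset (map ?v [1..<Suc n]) = mset (map w [1..<Suc n])"
    using one_line_stack_sort_perm[of n w] mset_stack_sort[of "one_line n w"]
    by (simp only: one_line_def)
  then have eq: "set (map ?v [1..<Suc n]) = set (map w [1..<Suc n])"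
    by (rule mset_eq_setD)
  then have "?v ` {1..n} = {1..n}"
    using permutes_image[OF assms] by (simp only: set_map *)
  then show "bij_betw ?v {1..n} {1..n}"
    by (simp add: bij_betw_def eq_card_imp_inj_on)
qed (auto simp: stack_sort_perm_def)

section \<open>Isomorphism of posets\<close>

definition poset_isomorphic ::
  "'a set \<Rightarrow> ('a \<Rightarrow> 'a \<Rightarrow> bool) \<Rightarrow> 'b set \<Rightarrow> ('b \<Rightarrow> 'b \<Rightarrow> bool) \<Rightarrow> bool" where
  "poset_isomorphic P leP Q leQ \<longleftrightarrow>
     (\<exists>f. bij_betw f P Q \<and> (\<forall>x\<in>P. \<forall>y\<in>P. leP x y \<longleftrightarrow> leQ (f x) (f y)))"

end

theory Submission
  imports Defs
begin

text \<open>
  Label each edge of the broom by its upper endpoint, so that the edges are \<open>1, \<dots>, n\<close>, and put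
  \<open>c = n - k\<close>. A tube with at least two vertices is determined by its set of edges, and a set of edges
  is connected iff it contains every \<open>m \<le> c\<close> lying strictly between two of its members. A ranking \<open>r\<close>
  of the edges yields a maximal nesting: the tube of \<open>e\<close> consists of the edges reachable from \<open>e\<close>
  through edges of rank at least \<open>r e\<close>. All maximal nestings arise in this way, and each has a unique
  canonical ranking, namely one without \<open>x < m < y\<close>, \<open>m \<le> c\<close>, \<open>r m < r x < r y\<close>. Under
  \<open>r e = w\<inverse>(n + 1 - e)\<close> these rankings are the permutations \<open>w\<close> without a 231-pattern whose first
  letter exceeds \<open>k\<close>, and ascents \<open>e < f\<close>, \<open>r e < r f\<close> become inversions of \<open>w\<close>. Since \<open>j\<close> precedes \<open>i < j\<close>
  in the stack-sorted word iff \<open>w\<close> contains \<open>j \<dots> z \<dots> i\<close> with \<open>z > j\<close>, this pattern condition says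
  exactly that the stack-sorted word lies below \<open>w\<^sub>\<circ>(k,n)\<close>.

  For the orders: exchanging two consecutive ranks either fixes the nesting or performs a flip, upwards if
  an ascent is created, so any chain in the weak order maps to a chain of nestings. Conversely, the ascents
  of a canonical ranking can be read off from the containments of tubes, and a flip upwards only adds to them.
\<close>

section \<open>Edges of a broom and the vertex sets they span\<close>

text \<open>The parent of the vertex \<open>x\<close> when the chain ends in the vertex
  \<open>c\<close>: one formula for chain vertices and leaves. Truncation gives
  \<open>par c 0 = 0\<close>, so the root has to be excluded by \<open>1 \<le> x\<close> where edges
  are meant.\<close>

definition par :: "nat \<Rightarrow> nat \<Rightarrow> nat" where
  "par c x = min (x - 1) c"

text \<open>The interior edges of the tree path joining the edges \<open>e\<close> and
  \<open>f\<close>. Only chain edges qualify, because any two leaf edges meet in the vertex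
  \<open>c\<close>.\<close>

definition btw :: "nat \<Rightarrow> nat \<Rightarrow> nat \<Rightarrow> nat \<Rightarrow> bool" where
  "btw c e m f \<longleftrightarrow> m \<le> c \<and> (e < m \<and> m < f \<or> f < m \<and> m < e)"

definition conv :: "nat \<Rightarrow> nat set \<Rightarrow> bool" where
  "conv c S \<longleftrightarrow> (\<forall>e\<in>S. \<forall>f\<in>S. \<forall>m. btw c e m f \<longrightarrow> m \<in> S)"

lemma convD: "conv c S \<Longrightarrow> e \<in> S \<Longrightarrow> f \<in> S \<Longrightarrow> btw c e m f \<Longrightarrow> m \<in> S"
  unfolding conv_def by blast

definition verts :: "nat \<Rightarrow> nat set \<Rightarrow> nat set" where
  "verts c S = S \<union> par c ` S"

definition edges :: "nat \<Rightarrow> nat set \<Rightarrow> nat set" where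
  "edges c A = {x \<in> A. 1 \<le> x \<and> par c x \<in> A}"

lemma edges_mono: "A \<subseteq> B \<Longrightarrow> edges c A \<subseteq> edges c B"
  by (auto simp: edges_def)

lemma verts_mono: "S \<subseteq> T \<Longrightarrow> verts c S \<subseteq> verts c T"
  by (auto simp: verts_def)

text \<open>An edge \<open>f\<close> outside \<open>S\<close> with both endpoints covered would lie
  between two edges of \<open>S\<close>: its upper endpoint is the parent of some \<open>g\<close>
  in \<open>S\<close>, and its lower endpoint can only be covered by the edge \<open>f - 1\<close>,
  since \<open>f\<close> is its only child.\<close>

lemma edges_verts:
  assumes "conv c S" "S \<subseteq> {1..n}"
  shows "edges c (verts c S) = S"
proof
  show "S \<subseteq> edges c (verts c S)"
    using assms by (auto simp: edges_def verts_def)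
  show "edges c (verts c S) \<subseteq> S"
  proof
    fix f assume "f \<in> edges c (verts c S)"
    then have f: "f \<in> verts c S" "1 \<le> f" "par c f \<in> verts c S"
      by (auto simp: edges_def)
    show "f \<in> S"
    proof (rule ccontr)
      assume nf: "f \<notin> S"
      then obtain g where g: "g \<in> S" "f = par c g"
        using f by (auto simp: verts_def)
      have "1 \<le> g" using g assms by auto
      have fc: "f \<le> c" "f < g" using g f by (auto simp: par_def)
      from f(3) consider "f - 1 \<in> S" | h where "h \<in> S" "par c h = f - 1"
        using fc by (auto simp: verts_def par_def min_def split: if_splits)
      then show False
      proof cases
        case 1
        have "btw c (f - 1) f g" using fc f by (auto simp: btw_def)
        then show ?thesis using convD[OF assms(1)] 1 g(1) nf by blast
      next
        case 2
        have "1 \<le> h" using 2 assms by auto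
        then have "h = f" using 2(2) fc f(2) unfolding par_def by linarith
        then show ?thesis using 2 nf by simp
      qed
    qed
  qed
qed

lemma verts_subset_iff:
  assumes "conv c S" "S \<subseteq> {1..n}" "conv c T" "T \<subseteq> {1..n}"
  shows "verts c S \<subseteq> verts c T \<longleftrightarrow> S \<subseteq> T"
  using edges_verts[OF assms(1,2)] edges_verts[OF assms(3,4)]
    edges_mono[of "verts c S" "verts c T" c] verts_mono[of S T c] by auto

lemma verts_atLeastAtMost:
  assumes "1 \<le> n"
  shows "verts c {1..n} = {0..n}"
proof
  show "verts c {1..n} \<subseteq> {0..n}" by (auto simp: verts_def par_def)
  show "{0..n} \<subseteq> verts c {1..n}"
  proof
    fix x assume "x \<in> {0..n}"
    moreover have "0 = par c 1" by (simp add: par_def)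
    then have "0 \<in> verts c {1..n}" using assms by (auto simp: verts_def)
    ultimately show "x \<in> verts c {1..n}" by (cases "x = 0") (auto simp: verts_def)
  qed
qed

text \<open>One step down from \<open>f\<close> towards \<open>e\<close>: the two edges touch, or
  the next edge on the path is \<open>par c f\<close>.\<close>

lemma par_cases:
  assumes "e < f"
  shows "par c f = e \<or> par c f = par c e \<or> e < par c f \<and> btw c e (par c f) f"
  using assms unfolding par_def btw_def min_def by (simp split: if_splits) linarith

text \<open>On the path from \<open>x\<close> to \<open>y\<close>, choose the edge outside
  \<open>S\<close> that is closest to \<open>x\<close>. All edges before it lie in \<open>S\<close>,
  so it touches \<open>S\<close>.\<close>

lemma exists_nearest_edge:
  assumes D: "conv c D" "D \<subseteq> {1..n}" "x \<in> D" "y \<in> D" and S: "x \<in> S" "y \<notin> S"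
  obtains g where "g \<in> D" "g \<notin> S" "g \<in> verts c S \<or> par c g \<in> verts c S"
    "g = y \<or> btw c x g y"
proof -
  define G where "G = {g \<in> D. g \<notin> S \<and> (g = y \<or> btw c x g y)}"
  define d where "d g = (if x \<le> g then g - x else x - g)" for g
  have "y \<in> G" using assms by (auto simp: G_def)
  then obtain g where g: "g \<in> G" and min: "\<And>h. h \<in> G \<Longrightarrow> d g \<le> d h"
    using ex_has_least_nat[of "\<lambda>g. g \<in> G" y d] by blast
  have near: "m \<in> S" if "btw c x m g" for m
  proof (rule ccontr)
    assume "m \<notin> S"
    moreover have "m \<in> D" using convD[OF D(1,3) _ that] g unfolding G_def by blast
    moreover have "btw c x m y" using that g unfolding G_def btw_def by auto
    ultimately have "m \<in> G" by (auto simp: G_def)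
    then have "d g \<le> d m" by (rule min)
    then show False using that unfolding d_def btw_def by (simp split: if_splits) linarith
  qed
  have gx: "g \<noteq> x" "1 \<le> g" "1 \<le> x" using g S D by (auto simp: G_def)
  have "g \<in> verts c S \<or> par c g \<in> verts c S"
  proof (cases "x < g")
    case True
    have "par c g = x \<or> par c g = par c x \<or> btw c x (par c g) g"
      using par_cases[OF True] by blast
    then show ?thesis using near[of "par c g"] S(1) unfolding verts_def by blast
  next
    case False
    then have "g < x" using gx by auto
    show ?thesis
    proof (cases "g \<le> c")
      case True
      \<comment> \<open>The upper endpoint of \<open>g\<close> is covered by the next edge towards
        \<open>x\<close>: this is \<open>x\<close> itself if \<open>x\<close> sits on
        \<open>g\<close>, and \<open>Suc g\<close> otherwise.\<close>
      have "par c x = g \<or> btw c x (Suc g) g \<and> par c (Suc g) = g"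
        using True \<open>g < x\<close> unfolding par_def btw_def by linarith
      then show ?thesis using near[of "Suc g"] S(1) unfolding verts_def by force
    next
      case f: False
      then have "par c g = par c x" using \<open>g < x\<close> by (auto simp: par_def)
      then show ?thesis using S(1) unfolding verts_def by simp
    qed
  qed
  then show ?thesis using that[of g] g unfolding G_def by blast
qed

text \<open>The edge \<open>g\<close> makes the two vertex sets meet and keeps \<open>T\<close> from
  lying inside \<open>S\<close>, which leaves one of the three laminar cases.\<close>

lemma touching_imp_subset:
  assumes "conv c S" "S \<subseteq> {1..n}" "conv c T" "T \<subseteq> {1..n}"
    and lam: "verts c S \<subseteq> verts c T \<or> verts c T \<subseteq> verts c S \<or> verts c S \<inter> verts c T = {}"
    and g: "g \<in> T" "g \<notin> S" "g \<in> verts c S \<or> par c g \<in> verts c S"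
  shows "S \<subseteq> T"
proof -
  have "g \<in> verts c T" "par c g \<in> verts c T" using g by (auto simp: verts_def)
  then have "verts c S \<inter> verts c T \<noteq> {}" using g by auto
  then show ?thesis using lam g verts_subset_iff assms(1-4) by (metis subsetD)
qed

section \<open>Tubes of a broom\<close>

lemma parent_child_broom_par:
  assumes "k \<le> n"
  shows "parent_child (broom k n) = {(par (n - k) i, i) |i. 1 \<le> i \<and> i \<le> n}"
proof -
  have "(\<exists>j. (a, b) = (j - 1, j) \<and> 1 \<le> j \<and> j \<le> n - k) \<or>
      (\<exists>j. (a, b) = (n - k, j) \<and> n - k + 1 \<le> j \<and> j \<le> n) \<longleftrightarrow>
      a = par (n - k) b \<and> 1 \<le> b \<and> b \<le> n" for a b
    by (auto simp: par_def)
  then show ?thesis unfolding parent_child_broom[OF assms] by auto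
qed

text \<open>Descending from the larger of two edges, \<open>par_cases\<close> and convexity keep the
  walk inside \<open>S\<close> until it reaches the smaller one.\<close>

lemma tube_verts:
  assumes "k \<le> n" and S: "conv (n - k) S" "S \<subseteq> {1..n}" "S \<noteq> {}"
  shows "tube (broom k n) (verts (n - k) S)"
proof -
  let ?c = "n - k" and ?A = "verts (n - k) S"
  let ?E = "Restr (parent_child (broom k n) \<union> (parent_child (broom k n))\<inverse>) ?A"
  have sy: "sym (?E\<^sup>*)" by (rule sym_rtrancl) (auto simp: sym_def)
  have e1: "(e, par ?c e) \<in> ?E" if "e \<in> S" for e
    using that S assms(1) by (auto simp: parent_child_broom_par verts_def)
  have up: "(f, e) \<in> ?E\<^sup>*" if "e \<in> S" "f \<in> S" "e < f" for e f
    using that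
  proof (induction f rule: less_induct)
    case (less f)
    have st: "(f, par ?c f) \<in> ?E\<^sup>*" using e1 less by blast
    consider "par ?c f = e" | "par ?c f = par ?c e" | "par ?c f > e" "btw ?c e (par ?c f) f"
      using par_cases[OF less(4)] by blast
    then show ?case
    proof cases
      case 2
      then have "(par ?c f, e) \<in> ?E\<^sup>*" using e1[OF less(2)] sy by (auto simp: sym_def)
      then show ?thesis using st by (rule rtrancl_trans[rotated])
    next
      case 3
      then have "par ?c f \<in> S" using convD[OF S(1)] less(2,3) by blast
      then have "(par ?c f, e) \<in> ?E\<^sup>*" using 3 less by (auto simp: btw_def)
      then show ?thesis using st by (rule rtrancl_trans[rotated])
    qed (use st in auto)
  qed
  have ee: "(e, f) \<in> ?E\<^sup>*" if "e \<in> S" "f \<in> S" for e f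
    using symD[OF sy up[OF that]] up[OF that(2,1)] by (cases e f rule: linorder_cases) auto
  have ve: "\<exists>e\<in>S. (x, e) \<in> ?E\<^sup>* \<and> (e, x) \<in> ?E\<^sup>*" if "x \<in> ?A" for x
  proof -
    obtain e where e: "e \<in> S" "x = e \<or> x = par ?c e" using \<open>x \<in> ?A\<close> by (auto simp: verts_def)
    then have "(e, x) \<in> ?E\<^sup>*" using e1[OF e(1)] by blast
    moreover from this have "(x, e) \<in> ?E\<^sup>*" by (rule symD[OF sy])
    ultimately show ?thesis using e(1) by blast
  qed
  have "(x, y) \<in> ?E\<^sup>*" if "x \<in> ?A" "y \<in> ?A" for x y
    using ve[OF that(1)] ve[OF that(2)] ee by (meson rtrancl_trans)
  moreover have "?A \<subseteq> {0..n}" using S by (fastforce simp: verts_def par_def)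
  ultimately show ?thesis using S assms(1) by (auto simp: tube_def vertices_broom verts_def)
qed

lemma tube_imp_verts:
  assumes "k \<le> n" and t: "tube (broom k n) A" "2 \<le> card A"
  shows "conv (n - k) (edges (n - k) A)" "edges (n - k) A \<subseteq> {1..n}"
    "A = verts (n - k) (edges (n - k) A)" "edges (n - k) A \<noteq> {}"
proof -
  let ?c = "n - k"
  let ?E = "Restr (parent_child (broom k n) \<union> (parent_child (broom k n))\<inverse>) A"
  have A: "A \<subseteq> {0..n}" and con: "\<And>x y. x \<in> A \<Longrightarrow> y \<in> A \<Longrightarrow> (x, y) \<in> ?E\<^sup>*"
    using t assms(1) by (auto simp: tube_def vertices_broom)
  show sub: "edges ?c A \<subseteq> {1..n}" using A by (auto simp: edges_def)
  \<comment> \<open>A second vertex exists, so connectedness gives \<open>x\<close> a neighbour in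
    \<open>A\<close> and thereby an incident edge.\<close>
  have "x \<in> verts ?c (edges ?c A)" if "x \<in> A" for x
  proof -
    have "\<not> A \<subseteq> {x}" using t(2) card_mono[of "{x}" A] by auto
    then obtain y where "y \<in> A" "y \<noteq> x" by auto
    then obtain z where "(x, z) \<in> ?E" using con[OF \<open>x \<in> A\<close> \<open>y \<in> A\<close>] by (metis converse_rtranclE)
    then show ?thesis using assms(1) by (auto simp: parent_child_broom_par edges_def verts_def)
  qed
  then show Av: "A = verts ?c (edges ?c A)" by (auto simp: edges_def verts_def)
  then show "edges ?c A \<noteq> {}" using t by (auto simp: tube_def verts_def)
  \<comment> \<open>The chain edge \<open>m\<close> is the only edge of the broom joining a vertex
    below \<open>m\<close> to one at or above \<open>m\<close>, so a walk in \<open>A\<close> that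
    crosses this border uses it.\<close>
  have cross: "y < m \<or> m \<in> edges ?c A" if "(x, y) \<in> ?E\<^sup>*" "x < m" "m \<le> ?c" for x y m
    using that
  proof (induction rule: rtrancl_induct)
    case (step y z)
    show ?case
    proof (cases "m \<in> edges ?c A \<or> z < m")
      case False
      then have "y < m" "m \<le> z" using step by auto
      with step.hyps(2) have "y = par ?c z" "z \<in> A" "y \<in> A"
        using assms(1) by (auto simp: parent_child_broom_par par_def)
      then have "m = z" using \<open>y < m\<close> \<open>m \<le> z\<close> \<open>m \<le> ?c\<close> by (auto simp: par_def)
      then show ?thesis using \<open>y = par ?c z\<close> \<open>z \<in> A\<close> \<open>y \<in> A\<close> \<open>x < m\<close> by (auto simp: edges_def)
    qed auto
  qed auto
  have "m \<in> edges ?c A" if "e \<in> edges ?c A" "f \<in> edges ?c A" "m \<le> ?c" "e < m" "m < f" for e f m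
    using cross[OF con[of e f] _ \<open>m \<le> ?c\<close>] that by (auto simp: edges_def)
  then show "conv ?c (edges ?c A)" unfolding conv_def btw_def by blast
qed

definition edge_sets :: "nat \<Rightarrow> nat \<Rightarrow> nat set set" where
  "edge_sets c n = {S. conv c S \<and> S \<subseteq> {1..n} \<and> S \<noteq> {}}"

lemma tube_iff:
  assumes "k \<le> n"
  shows "tube (broom k n) A \<and> 2 \<le> card A \<longleftrightarrow> A \<in> verts (n - k) ` edge_sets (n - k) n"
proof
  assume "tube (broom k n) A \<and> 2 \<le> card A"
  then show "A \<in> verts (n - k) ` edge_sets (n - k) n"
    using tube_imp_verts[OF assms, of A] by (intro image_eqI[of _ _ "edges (n - k) A"]) (auto simp: edge_sets_def)
next
  assume "A \<in> verts (n - k) ` edge_sets (n - k) n"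
  then obtain S where S: "conv (n - k) S" "S \<subseteq> {1..n}" "S \<noteq> {}" "A = verts (n - k) S"
    by (auto simp: edge_sets_def)
  then obtain e where "e \<in> S" by auto
  then have "1 \<le> e" using S by auto
  then have "par (n - k) e \<noteq> e" by (auto simp: par_def)
  then have "card {e, par (n - k) e} = 2" by auto
  moreover have "{e, par (n - k) e} \<subseteq> A" using \<open>e \<in> S\<close> S by (auto simp: verts_def)
  moreover have "finite A" using S finite_subset[OF S(2)] by (auto simp: verts_def)
  ultimately have "2 \<le> card A" by (metis card_mono)
  then show "tube (broom k n) A \<and> 2 \<le> card A" using tube_verts[OF assms] S by auto
qed

definition edge_nesting :: "nat \<Rightarrow> nat \<Rightarrow> nat set set \<Rightarrow> bool" where
  "edge_nesting c n N \<longleftrightarrow> {0..n} \<in> N \<and> N \<subseteq> verts c ` edge_sets c n \<and>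
     (\<forall>A\<in>N. \<forall>B\<in>N. A \<subseteq> B \<or> B \<subseteq> A \<or> A \<inter> B = {})"

lemma nesting_broom_iff: "k \<le> n \<Longrightarrow> nesting (broom k n) N \<longleftrightarrow> edge_nesting (n - k) n N"
  using tube_iff[of k n] vertices_broom[of k n] by (auto simp: nesting_def edge_nesting_def)

section \<open>Nestings from rankings of the edges\<close>

text \<open>For injective \<open>r\<close>, the connected component of \<open>e\<close> among the
  edges of rank at least \<open>r e\<close>, described through the path from \<open>e\<close> to
  \<open>f\<close>.\<close>

definition sees :: "nat \<Rightarrow> nat \<Rightarrow> (nat \<Rightarrow> nat) \<Rightarrow> nat \<Rightarrow> nat set" where
  "sees c n r e = {f \<in> {1..n}. r e \<le> r f \<and> (\<forall>m. btw c e m f \<longrightarrow> r e < r m)}"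

text \<open>Cut the edges in order of increasing rank; each edge contributes the component in which
  it is cut.\<close>

definition Nest :: "nat \<Rightarrow> nat \<Rightarrow> (nat \<Rightarrow> nat) \<Rightarrow> nat set set" where
  "Nest c n r = (\<lambda>e. verts c (sees c n r e)) ` {1..n}"

lemma sees_subset: "sees c n r e \<subseteq> {1..n}"
  by (auto simp: sees_def)

lemma sees_self: "e \<in> {1..n} \<Longrightarrow> e \<in> sees c n r e"
  by (auto simp: sees_def btw_def)

lemma sees_rank_le: "f \<in> sees c n r e \<Longrightarrow> r e \<le> r f"
  by (simp add: sees_def)

text \<open>In a tree, the path from \<open>e\<close> to \<open>f\<close> is covered by the paths
  from \<open>e\<close> to \<open>g\<close> and from \<open>g\<close> to \<open>f\<close>.\<close>

lemma btw_split: "btw c e m f \<Longrightarrow> m = g \<or> btw c e m g \<or> btw c g m f"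
  unfolding btw_def by linarith

lemma btw_trans: "btw c e m f \<Longrightarrow> btw c e l m \<Longrightarrow> btw c e l f"
  unfolding btw_def by linarith

lemma btw_commute: "btw c e m f \<longleftrightarrow> btw c f m e"
  unfolding btw_def by blast

lemma btw_range: "btw c e m f \<Longrightarrow> e \<in> {1..n} \<Longrightarrow> f \<in> {1..n} \<Longrightarrow> m \<in> {1..n}"
  unfolding btw_def by auto

lemma sees_rank_less:
  assumes "inj_on r {1..n}" "e \<in> {1..n}" "f \<in> sees c n r e" "f \<noteq> e"
  shows "r e < r f"
proof -
  have "r e \<le> r f" "f \<in> {1..n}" using assms(3) by (auto simp: sees_def)
  moreover have "r e \<noteq> r f" using assms calculation by (auto dest: inj_onD)
  ultimately show ?thesis by simp
qed

lemma sees_btw: "f \<in> sees c n r e \<Longrightarrow> btw c e m f \<Longrightarrow> e \<in> {1..n} \<Longrightarrow> m \<in> sees c n r e"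
  unfolding sees_def using btw_trans btw_range by (blast intro: less_imp_le)

lemma conv_sees:
  assumes "e \<in> {1..n}"
  shows "conv c (sees c n r e)"
  unfolding conv_def
proof (intro ballI allI impI)
  fix f g m assume f: "f \<in> sees c n r e" and g: "g \<in> sees c n r e" and "btw c f m g"
  then have "m = e \<or> btw c e m f \<or> btw c e m g" using btw_split btw_commute by blast
  then show "m \<in> sees c n r e" using sees_btw sees_self assms f g by metis
qed

lemma sees_edge_sets: "e \<in> {1..n} \<Longrightarrow> sees c n r e \<in> edge_sets c n"
  using conv_sees[of e n c r] sees_subset[of c n r e] sees_self[of e n c r] unfolding edge_sets_def by blast

lemma edges_verts_sees: "e \<in> {1..n} \<Longrightarrow> edges c (verts c (sees c n r e)) = sees c n r e"
  by (rule edges_verts[OF conv_sees sees_subset])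

lemma sees_trans:
  assumes r: "inj_on r {1..n}" and e: "e \<in> {1..n}" and f: "f \<in> sees c n r e" and g: "g \<in> sees c n r f"
  shows "g \<in> sees c n r e"
proof (cases "f = e")
  case False
  then have ef: "r e < r f" using sees_rank_less[OF r e f] by simp
  have "r e < r m" if "btw c e m g" for m
    using btw_split[OF that, of f] ef f g unfolding sees_def by auto
  then show ?thesis using ef g unfolding sees_def by auto
qed (use g in simp)

lemma sees_antisym:
  assumes "inj_on r {1..n}" "e \<in> {1..n}" "f \<in> sees c n r e" "e \<in> sees c n r f"
  shows "e = f"
  using sees_rank_less[OF assms(1-3)] sees_rank_le[OF assms(4)] by force

lemma inj_on_verts_sees:
  assumes "inj_on r {1..n}"
  shows "inj_on (\<lambda>e. verts c (sees c n r e)) {1..n}"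
proof (rule inj_onI)
  fix e f assume e: "e \<in> {1..n}" "f \<in> {1..n}" "verts c (sees c n r e) = verts c (sees c n r f)"
  then have "sees c n r e = sees c n r f" using edges_verts_sees by metis
  then show "e = f" using sees_antisym[OF assms e(1)] sees_self e by metis
qed

lemma not_btw_adjacent:
  assumes "1 \<le> g" "1 \<le> h" "v = g \<or> v = par c g" "v = h \<or> v = par c h"
  shows "\<not> btw c g m h"
  using assms unfolding par_def btw_def by linarith

text \<open>The path from \<open>e\<close> to \<open>g\<close> adds at most the edge
  \<open>h\<close> touching \<open>g\<close> to the path from \<open>e\<close> to
  \<open>h\<close>.\<close>

lemma sees_adjacent:
  assumes r: "inj_on r {1..n}" and e: "e \<in> {1..n}" and g: "g \<in> {1..n}" "r e \<le> r g"
    and ad: "g \<in> verts c (sees c n r e) \<or> par c g \<in> verts c (sees c n r e)"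
  shows "g \<in> sees c n r e"
proof -
  obtain h v where h: "h \<in> sees c n r e" "v = g \<or> v = par c g" "v = h \<or> v = par c h"
    using ad unfolding verts_def by blast
  then have "h \<in> {1..n}" using sees_subset by blast
  have "r e < r m" if m: "btw c e m g" for m
  proof -
    have "\<not> btw c g m h" using not_btw_adjacent[OF _ _ h(2,3)] g(1) \<open>h \<in> {1..n}\<close> by auto
    then have "m = h \<or> btw c e m h" using btw_split[OF m, of h] btw_commute by blast
    then show ?thesis
    proof
      assume "m = h"
      then have "h \<noteq> e" using m by (auto simp: btw_def)
      then show ?thesis using sees_rank_less[OF r e h(1)] \<open>m = h\<close> by simp
    qed (use h(1) in \<open>simp add: sees_def\<close>)
  qed
  then show ?thesis using g by (simp add: sees_def)
qed

text \<open>A common vertex provides an edge \<open>h\<close> of the component of \<open>f\<close>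
  that touches the component of \<open>e\<close>; its rank is high enough to belong to both. The
  path from \<open>e\<close> to \<open>f\<close> then runs inside the paths through
  \<open>h\<close>, so \<open>e\<close> sees \<open>f\<close>.\<close>

lemma sees_laminar:
  assumes r: "inj_on r {1..n}" and e: "e \<in> {1..n}" and f: "f \<in> {1..n}"
    and meet: "verts c (sees c n r e) \<inter> verts c (sees c n r f) \<noteq> {}" and le: "r e \<le> r f"
  shows "sees c n r f \<subseteq> sees c n r e"
proof -
  obtain h where h: "h \<in> sees c n r f" and hv: "h \<in> verts c (sees c n r e) \<or> par c h \<in> verts c (sees c n r e)"
    using meet unfolding verts_def[of c "sees c n r f"] by blast
  have hn: "h \<in> {1..n}" using h sees_subset by blast
  have "r f \<le> r h" using h by (rule sees_rank_le)
  then have he: "h \<in> sees c n r e" using sees_adjacent[OF r e hn _ hv] le by simp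
  have "r e < r m" if m: "btw c e m f" for m
  proof -
    consider "m = h" | "btw c e m h" | "btw c f m h" using btw_split[OF m, of h] btw_commute by blast
    then show ?thesis
    proof cases
      case 1
      then have "h \<noteq> e" using m by (auto simp: btw_def)
      then show ?thesis using sees_rank_less[OF r e he] 1 by simp
    next
      case 2 then show ?thesis using he by (simp add: sees_def)
    next
      case 3 
      then have "r f < r m" using h by (simp add: sees_def)
      then show ?thesis using le by simp
    qed
  qed
  then have "f \<in> sees c n r e" using f le by (simp add: sees_def)
  then show ?thesis using sees_trans[OF r e] by blast
qed

section \<open>Rankings yield exactly the maximal nestings\<close>

text \<open>The edge of least rank sees every edge, which supplies the full vertex set; two
  components that meet are compared by the ranks of their defining edges.\<close>

lemma edge_nesting_Nest:
  assumes n: "1 \<le> n" and r: "inj_on r {1..n}"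
  shows "edge_nesting c n (Nest c n r)"
proof -
  obtain e where e: "e \<in> {1..n}" "\<And>f. f \<in> {1..n} \<Longrightarrow> r e \<le> r f"
    using ex_has_least_nat[of "\<lambda>e. e \<in> {1..n}" 1 r] n by auto
  have "f \<in> sees c n r e" if f: "f \<in> {1..n}" for f
  proof -
    have "r e < r m" if "btw c e m f" for m
    proof -
      have "m \<in> {1..n}" "m \<noteq> e" using btw_range[OF that e(1) f] that by (auto simp: btw_def)
      then have "r m \<noteq> r e" using r e(1) by (auto dest: inj_onD)
      then show ?thesis using e(2)[OF \<open>m \<in> {1..n}\<close>] by simp
    qed
    then show ?thesis using e f by (simp add: sees_def)
  qed
  then have "sees c n r e = {1..n}" using sees_subset by blast
  then have "{0..n} \<in> Nest c n r"
    using e(1) verts_atLeastAtMost[OF n, of c] image_eqI[of _ "\<lambda>e. verts c (sees c n r e)" e "{1..n}"]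
    unfolding Nest_def by simp
  moreover have "A \<subseteq> B \<or> B \<subseteq> A \<or> A \<inter> B = {}" if AB: "A \<in> Nest c n r" "B \<in> Nest c n r" for A B
  proof -
    obtain e where e: "e \<in> {1..n}" "A = verts c (sees c n r e)"
      using AB(1) unfolding Nest_def by (rule imageE)
    obtain f where f: "f \<in> {1..n}" "B = verts c (sees c n r f)"
      using AB(2) unfolding Nest_def by (rule imageE)
    show ?thesis
    proof (cases "A \<inter> B = {}")
      case False
      have "sees c n r f \<subseteq> sees c n r e" if "r e \<le> r f"
        using sees_laminar[OF r e(1) f(1) _ that] False e f by simp
      moreover have "sees c n r e \<subseteq> sees c n r f" if "r f \<le> r e"
        using sees_laminar[OF r f(1) e(1) _ that] False e f by (simp add: inf_commute)
      ultimately have "sees c n r f \<subseteq> sees c n r e \<or> sees c n r e \<subseteq> sees c n r f"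
        using linear[of "r e" "r f"] by argo
      then show ?thesis unfolding e f using verts_mono by blast
    qed simp
  qed
  moreover have "Nest c n r \<subseteq> verts c ` edge_sets c n"
    unfolding Nest_def by (intro image_subsetI imageI sees_edge_sets)
  ultimately show ?thesis unfolding edge_nesting_def by blast
qed

lemma edge_nestingD:
  assumes "edge_nesting c n N" "A \<in> N"
  obtains S where "A = verts c S" "conv c S" "S \<subseteq> {1..n}" "S \<noteq> {}" "edges c A = S"
proof -
  obtain S where "S \<in> edge_sets c n" "A = verts c S"
    using assms unfolding edge_nesting_def by blast
  then show ?thesis using that[of S] edges_verts[of c S n] unfolding edge_sets_def by blast
qed

text \<open>Laminarity enters the maximality arguments and the analysis of flips in this form: an
  edge \<open>g\<close> on the boundary of \<open>A\<close> detects larger tubes.\<close>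

lemma edge_nesting_touching:
  assumes N: "edge_nesting c n N" "A \<in> N" "B \<in> N"
    and g: "g \<in> edges c B" "g \<notin> edges c A" "g \<in> A \<or> par c g \<in> A"
  shows "A \<subset> B"
proof -
  obtain S where S: "A = verts c S" "conv c S" "S \<subseteq> {1..n}" "edges c A = S" using edge_nestingD[OF N(1,2)] by metis
  obtain T where T: "B = verts c T" "conv c T" "T \<subseteq> {1..n}" "edges c B = T" using edge_nestingD[OF N(1,3)] by metis
  have lam: "verts c S \<subseteq> verts c T \<or> verts c T \<subseteq> verts c S \<or> verts c S \<inter> verts c T = {}"
    using N S T unfolding edge_nesting_def by blast
  have "S \<subseteq> T" by (rule touching_imp_subset[OF S(2,3) T(2,3) lam]) (use g S T in auto)
  then show ?thesis using S T g verts_mono by blast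
qed

text \<open>Take the edge of least rank in \<open>S\<close>: by convexity, all paths from it to
  edges of \<open>S\<close> stay in \<open>S\<close>.\<close>

lemma edge_set_min:
  assumes r: "inj_on r {1..n}" and S: "conv c S" "S \<subseteq> {1..n}" "S \<noteq> {}"
  obtains e where "e \<in> S" "S \<subseteq> sees c n r e"
proof -
  obtain e where e: "e \<in> S" "\<And>f. f \<in> S \<Longrightarrow> r e \<le> r f"
    using ex_has_least_nat[of "\<lambda>e. e \<in> S" _ r] S by blast
  have "f \<in> sees c n r e" if f: "f \<in> S" for f
  proof -
    have "r e < r m" if "btw c e m f" for m
    proof -
      have "m \<in> S" "m \<noteq> e" using convD[OF S(1) e(1) f that] that by (auto simp: btw_def)
      then have "r m \<noteq> r e" using r e(1) S(2) by (auto dest: inj_onD)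
      then show ?thesis using e(2)[OF \<open>m \<in> S\<close>] by simp
    qed
    then show ?thesis using e f S(2) by (auto simp: sees_def)
  qed
  then show ?thesis using that e by blast
qed

text \<open>Let \<open>e\<close> be the edge of least rank in \<open>A\<close>, so that its
  component contains \<open>A\<close>. Were the component larger, some edge \<open>g\<close> of it
  would lie on the boundary of \<open>A\<close>; the last assumption excludes this.\<close>

lemma Nest_criterion:
  assumes r: "inj_on r {1..n}" and N: "edge_nesting c n N" and A: "A \<in> N"
    and "\<And>e g. e \<in> edges c A \<Longrightarrow> g \<in> {1..n} \<Longrightarrow> g \<notin> edges c A \<Longrightarrow> g \<in> A \<or> par c g \<in> A
      \<Longrightarrow> g \<in> sees c n r e \<Longrightarrow> edges c A \<subseteq> sees c n r e \<Longrightarrow> False"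
  shows "A \<in> Nest c n r"
proof -
  obtain S where S: "A = verts c S" "conv c S" "S \<subseteq> {1..n}" "S \<noteq> {}" "edges c A = S"
    using edge_nestingD[OF N A] by metis
  obtain e where e: "e \<in> S" "S \<subseteq> sees c n r e" using edge_set_min[OF r S(2-4)] by metis
  then have en: "e \<in> {1..n}" using S by blast
  have "sees c n r e \<subseteq> S"
  proof (rule ccontr)
    assume "\<not> sees c n r e \<subseteq> S"
    then obtain y where y: "y \<in> sees c n r e" "y \<notin> S" by blast
    obtain g where g: "g \<in> sees c n r e" "g \<notin> S" "g \<in> verts c S \<or> par c g \<in> verts c S"
      by (rule exists_nearest_edge[OF conv_sees[OF en] sees_subset subsetD[OF e(2,1)] y(1) e(1) y(2)])
    show False
      by (rule assms(4)[of e g]) (use g S(1,5) e subsetD[OF sees_subset g(1)] in simp_all)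
  qed
  then have "S = sees c n r e" using e by blast
  then show ?thesis using S(1) en unfolding Nest_def by blast
qed

text \<open>A boundary edge \<open>g\<close> seen by \<open>e\<close> has its own component in
  \<open>N\<close>. That tube strictly contains \<open>A\<close>, hence \<open>e\<close>, so
  \<open>e\<close> and \<open>g\<close> would see each other.\<close>

lemma Nest_maximal:
  assumes r: "inj_on r {1..n}" and N: "edge_nesting c n N" "Nest c n r \<subseteq> N"
  shows "N = Nest c n r"
proof (rule antisym[OF _ N(2)], rule subsetI)
  fix A assume A: "A \<in> N"
  show "A \<in> Nest c n r"
  proof (rule Nest_criterion[OF r N(1) A])
    fix e g assume e: "e \<in> edges c A" and g: "g \<in> {1..n}" "g \<notin> edges c A" "g \<in> A \<or> par c g \<in> A"
      "g \<in> sees c n r e"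
    have en: "e \<in> {1..n}" by (rule edge_nestingD[OF N(1) A]) (use e in blast)
    let ?B = "verts c (sees c n r g)"
    have "?B \<in> N" using N(2) g unfolding Nest_def by blast
    moreover have "g \<in> edges c ?B" using edges_verts_sees sees_self g by metis
    ultimately have "A \<subset> ?B" by (rule edge_nesting_touching[OF N(1) A _ _ g(2,3)])
    then have "e \<in> sees c n r g" using e edges_mono[of A ?B c] edges_verts_sees[OF g(1)] by auto
    then have "e = g" using sees_antisym[OF r en g(4)] by simp
    then show False using e g by simp
  qed
qed

text \<open>Order the edges by \<open>h\<close>, breaking ties by label, and count how many come at
  or after \<open>e\<close>.\<close>

lemma exists_ranking:
  fixes h :: "nat \<Rightarrow> nat"
  obtains r where "bij_betw r {1..n} {1..n}"
    "\<And>e f. e \<in> {1..n} \<Longrightarrow> f \<in> {1..n} \<Longrightarrow> h e < h f \<Longrightarrow> r f < r e"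
proof -
  define key where "key e f \<longleftrightarrow> h e < h f \<or> h e = h f \<and> e \<le> f" for e f
  define r where "r e = card {f \<in> {1..n}. key e f}" for e
  have less: "r f < r e" if "e \<in> {1..n}" "key e f" "e \<noteq> f" for e f
    unfolding r_def
  proof (rule psubset_card_mono)
    have "{g \<in> {1..n}. key f g} \<subseteq> {g \<in> {1..n}. key e g}" using that by (auto simp: key_def)
    moreover have "e \<in> {g \<in> {1..n}. key e g}" "e \<notin> {g \<in> {1..n}. key f g}" using that by (auto simp: key_def)
    ultimately show "{g \<in> {1..n}. key f g} \<subset> {g \<in> {1..n}. key e g}" by blast
  qed simp
  have total: "key e f \<or> key f e" for e f by (auto simp: key_def)
  have inj: "inj_on r {1..n}"
    using less total by (intro inj_onI) (metis less_irrefl)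
  have "r ` {1..n} \<subseteq> {1..n}"
  proof
    fix y assume "y \<in> r ` {1..n}"
    then obtain e where e: "e \<in> {1..n}" "y = r e" by blast
    have "card {e} \<le> r e" unfolding r_def using e by (intro card_mono) (auto simp: key_def)
    moreover have "r e \<le> card {1..n}" unfolding r_def by (intro card_mono) auto
    ultimately show "y \<in> {1..n}" using e by simp
  qed
  then have "bij_betw r {1..n} {1..n}" using inj by (simp add: bij_betw_def endo_inj_surj)
  moreover have "r f < r e" if "e \<in> {1..n}" "h e < h f" for e f
    using less[OF that(1), of f] that by (auto simp: key_def)
  ultimately show ?thesis using that by blast
qed

text \<open>With \<open>h e\<close> the size of the smallest tube through \<open>e\<close>, the
  ranking cuts edges of large tubes first. A boundary edge of \<open>A\<close> lies only in tubes
  strictly larger than \<open>A\<close>, so it is cut before every edge of \<open>A\<close> and no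
  edge of \<open>A\<close> sees it.\<close>

lemma edge_nesting_subset_Nest:
  assumes n: "1 \<le> n" and N: "edge_nesting c n N"
  obtains r where "bij_betw r {1..n} {1..n}" "N \<subseteq> Nest c n r"
proof -
  define h where "h e = Min (card ` {A \<in> N. e \<in> edges c A})" for e
  have "N \<subseteq> Pow {0..n}"
  proof
    fix A assume "A \<in> N"
    then obtain S where "A = verts c S" "S \<subseteq> {1..n}" using edge_nestingD[OF N] by metis
    then show "A \<in> Pow {0..n}" using verts_mono[of S "{1..n}" c] verts_atLeastAtMost[OF n] by auto
  qed
  then have fin: "finite N" "\<And>A. A \<in> N \<Longrightarrow> finite A" by (auto intro: finite_subset)
  have h_le: "h e \<le> card A" if "A \<in> N" "e \<in> edges c A" for A e
    unfolding h_def using fin that by (intro Min_le) auto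
  have h_ex: "\<exists>A\<in>N. e \<in> edges c A \<and> h e = card A" if "e \<in> {1..n}" for e
  proof -
    have "e \<in> edges c {0..n}" using that by (auto simp: edges_def par_def)
    then have "card ` {A \<in> N. e \<in> edges c A} \<noteq> {}" using N by (auto simp: edge_nesting_def)
    then have "h e \<in> card ` {A \<in> N. e \<in> edges c A}" unfolding h_def using fin by (intro Min_in) auto
    then show ?thesis by auto
  qed
  obtain r where r: "bij_betw r {1..n} {1..n}"
    "\<And>e f. e \<in> {1..n} \<Longrightarrow> f \<in> {1..n} \<Longrightarrow> h e < h f \<Longrightarrow> r f < r e"
    using exists_ranking by blast
  have "A \<in> Nest c n r" if A: "A \<in> N" for A
  proof (rule Nest_criterion[OF bij_betw_imp_inj_on[OF r(1)] N A])
    fix e g assume e: "e \<in> edges c A" and g: "g \<in> {1..n}" "g \<notin> edges c A" "g \<in> A \<or> par c g \<in> A"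
      "g \<in> sees c n r e"
    have en: "e \<in> {1..n}" by (rule edge_nestingD[OF N A]) (use e in blast)
    obtain B where B: "B \<in> N" "g \<in> edges c B" "h g = card B" using h_ex[OF g(1)] by blast
    have "A \<subset> B" by (rule edge_nesting_touching[OF N A B(1,2) g(2,3)])
    then have "card A < card B" using fin B psubset_card_mono by blast
    then have "r g < r e" using r(2)[OF en g(1)] h_le[OF A e] B by simp
    then show False using g(4) sees_rank_le by fastforce
  qed
  then show ?thesis using that r by blast
qed

lemma MN_broom:
  assumes "1 \<le> k" "k \<le> n"
  shows "MN (broom k n) = Nest (n - k) n ` {r. bij_betw r {1..n} {1..n}}"
proof -
  have n: "1 \<le> n" using assms by simp
  have M: "N \<in> MN (broom k n) \<longleftrightarrow> edge_nesting (n - k) n N \<and>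
      (\<forall>N'. edge_nesting (n - k) n N' \<and> N \<subseteq> N' \<longrightarrow> N' = N)" for N
    by (simp add: MN_def nesting_broom_iff[OF assms(2)])
  show ?thesis
  proof (intro equalityI subsetI)
    fix N assume "N \<in> MN (broom k n)"
    then have N: "edge_nesting (n - k) n N" and
      max: "\<And>N'. edge_nesting (n - k) n N' \<Longrightarrow> N \<subseteq> N' \<Longrightarrow> N' = N" unfolding M by auto
    obtain r where r: "bij_betw r {1..n} {1..n}" "N \<subseteq> Nest (n - k) n r"
      using edge_nesting_subset_Nest[OF n N] by blast
    then show "N \<in> Nest (n - k) n ` {r. bij_betw r {1..n} {1..n}}"
      using max[OF edge_nesting_Nest[OF n bij_betw_imp_inj_on[OF r(1)]]] by blast
  next
    fix N assume "N \<in> Nest (n - k) n ` {r. bij_betw r {1..n} {1..n}}"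
    then obtain r where r: "inj_on r {1..n}" "N = Nest (n - k) n r" by (auto dest: bij_betw_imp_inj_on)
    then show "N \<in> MN (broom k n)"
      unfolding M using edge_nesting_Nest[OF n r(1)] Nest_maximal[OF r(1)] by blast
  qed
qed

section \<open>Swapping adjacent ranks\<close>

text \<open>All pairs of labels, not just neighbouring ones: the reflection of labels turns them
  into inversions, so their inclusion is the weak order.\<close>

definition ascents :: "nat \<Rightarrow> (nat \<Rightarrow> nat) \<Rightarrow> (nat \<times> nat) set" where
  "ascents n r = {(e, f). e \<in> {1..n} \<and> f \<in> {1..n} \<and> e < f \<and> r e < r f}"

definition swap :: "nat \<Rightarrow> nat \<Rightarrow> (nat \<Rightarrow> nat) \<Rightarrow> nat \<Rightarrow> nat" where
  "swap x y r = r(x := r y, y := r x)"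

lemma swap_simps: "swap x y r x = r y" "swap x y r y = r x"
  "g \<noteq> x \<Longrightarrow> g \<noteq> y \<Longrightarrow> swap x y r g = r g"
  by (auto simp: swap_def)

lemma swap_swap: "swap y x (swap x y r) = r"
  by (auto simp: swap_def)

lemma bij_betw_swap:
  assumes "bij_betw r A B" "x \<in> A" "y \<in> A"
  shows "bij_betw (swap x y r) A B"
proof -
  have "swap x y r = r \<circ> transpose x y"
    by (auto simp: swap_def transpose_def)
  moreover have "bij_betw (transpose x y) A A"
    using assms(2,3) by simp
  ultimately show ?thesis using bij_betw_trans assms(1) by metis
qed

lemma finite_ascents: "finite (ascents n r)"
  by (rule finite_subset[of _ "{1..n} \<times> {1..n}"]) (auto simp: ascents_def)

text \<open>No rank lies strictly between \<open>r x\<close> and \<open>r y\<close>, so only the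
  comparison of \<open>x\<close> with \<open>y\<close> changes.\<close>

lemma ascents_swap:
  assumes r: "inj_on r {1..n}" and x: "x \<in> {1..n}" and y: "y \<in> {1..n}" and xy: "r y = Suc (r x)" "x < y"
  shows "ascents n (swap x y r) = ascents n r - {(x, y)}"
proof -
  have ne: "g \<in> {1..n} \<Longrightarrow> g \<noteq> x \<Longrightarrow> r g \<noteq> r x" "g \<in> {1..n} \<Longrightarrow> g \<noteq> y \<Longrightarrow> r g \<noteq> r y" for g
    using r x y by (auto dest: inj_onD)
  have "swap x y r e < swap x y r f \<longleftrightarrow> r e < r f \<and> (e, f) \<noteq> (x, y)"
    if ef: "e \<in> {1..n}" "f \<in> {1..n}" "e < f" for e f
  proof -
    consider "e = x" "f = y" | "e = x" "f \<noteq> x" "f \<noteq> y" | "e = y" "f \<noteq> x" "f \<noteq> y"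
      | "f = x" "e \<noteq> x" "e \<noteq> y" | "f = y" "e \<noteq> x" "e \<noteq> y" | "e \<noteq> x" "e \<noteq> y" "f \<noteq> x" "f \<noteq> y"
      using ef(3) xy(2) by (cases "e = x"; cases "e = y"; cases "f = x"; cases "f = y") auto
    then show ?thesis
      using ne(1)[OF ef(1)] ne(2)[OF ef(1)] ne(1)[OF ef(2)] ne(2)[OF ef(2)] xy
      by cases (auto simp: swap_simps)
  qed
  then show ?thesis by (auto simp: ascents_def)
qed

text \<open>The only comparison that is reversed is the one between \<open>x\<close> and
  \<open>y\<close>; the component of \<open>g\<close> depends on it only if \<open>g = x\<close> and
  \<open>x\<close> sees \<open>y\<close>.\<close>

lemma sees_subset_swap:
  assumes r: "inj_on r {1..n}" and x: "x \<in> {1..n}" and y: "y \<in> {1..n}" and xy: "r y = Suc (r x)"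
    and g: "g \<in> {1..n}" "g = x \<Longrightarrow> y \<notin> sees c n r x"
  shows "sees c n r g \<subseteq> sees c n (swap x y r) g"
proof
  fix f assume f: "f \<in> sees c n r g"
  then have fn: "f \<in> {1..n}" using sees_subset by blast
  have ne: "g \<in> {1..n} \<Longrightarrow> g \<noteq> x \<Longrightarrow> r g \<noteq> r x" "g \<in> {1..n} \<Longrightarrow> g \<noteq> y \<Longrightarrow> r g \<noteq> r y" for g
    using r x y by (auto dest: inj_onD)
  have key: "swap x y r g < swap x y r m" if m: "m \<in> sees c n r g" "m \<noteq> g" for m
  proof -
    have lt: "r g < r m" using sees_rank_less[OF r g(1) m] .
    have mn: "m \<in> {1..n}" using m(1) sees_subset by blast
    have xx: "g = x \<Longrightarrow> m \<noteq> y" using g(2) m(1) by blast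
    show ?thesis
      using lt xx xy(1) ne[OF mn] ne[OF g(1)]
      by (cases "g = x"; cases "g = y"; cases "m = x"; cases "m = y") (simp_all add: swap_def)
  qed
  have "swap x y r g \<le> swap x y r f" using key[OF f] by (cases "f = g") auto
  moreover have "swap x y r g < swap x y r m" if m: "btw c g m f" for m
    using key[OF sees_btw[OF f m g(1)]] m by (auto simp: btw_def)
  ultimately show "f \<in> sees c n (swap x y r) g" using fn by (simp add: sees_def)
qed

text \<open>The component of \<open>x\<close> contains \<open>y\<close>, and after the swap
  \<open>y\<close> is its edge of least rank.\<close>

lemma sees_subset_swap_top:
  assumes r: "inj_on r {1..n}" and x: "x \<in> {1..n}" and xy: "r y = Suc (r x)"
    and y: "y \<in> sees c n r x"
  shows "sees c n r x \<subseteq> sees c n (swap x y r) y"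
proof
  fix g assume g: "g \<in> sees c n r x"
  have le: "r x < swap x y r m" if "m \<in> sees c n r x" "m \<noteq> y" for m
    using sees_rank_less[OF r x that(1)] that xy by (auto simp: swap_def)
  have "m \<in> sees c n r x" "m \<noteq> y" if "btw c y m g" for m
    using convD[OF conv_sees[OF x] y g that] that by (auto simp: btw_def)
  then have "\<forall>m. btw c y m g \<longrightarrow> r x < swap x y r m" using le by blast
  moreover have "r x \<le> swap x y r g" using le[OF g] swap_simps(2)[of x y r] by (cases "g = y") auto
  moreover have "g \<in> {1..n}" using g sees_subset by blast
  ultimately show "g \<in> sees c n (swap x y r) y" by (simp add: sees_def swap_simps)
qed

context
  fixes c n x y :: nat and r :: "nat \<Rightarrow> nat"
  assumes r: "bij_betw r {1..n} {1..n}" and x: "x \<in> {1..n}" and y: "y \<in> {1..n}" and xy: "r y = Suc (r x)"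
begin

private lemma inj_r: "inj_on r {1..n}"
  using r by (rule bij_betw_imp_inj_on)

private lemma inj_swap: "inj_on (swap x y r) {1..n}"
  using bij_betw_swap[OF r x y] by (rule bij_betw_imp_inj_on)

private lemma rank_swap: "swap x y r x = Suc (swap x y r y)"
  using xy by (simp add: swap_simps)

text \<open>Swapping back is the same operation with \<open>x\<close> and \<open>y\<close>
  exchanged, so each inclusion also yields its converse. The next two lemmas use the same
  symmetry.\<close>

lemma sees_swap_iff: "x \<in> sees c n (swap x y r) y \<longleftrightarrow> y \<in> sees c n r x"
proof
  assume "y \<in> sees c n r x"
  then show "x \<in> sees c n (swap x y r) y"
    using sees_subset_swap_top[OF inj_r x xy] sees_self[OF x] by blast
next
  assume "x \<in> sees c n (swap x y r) y"
  then show "y \<in> sees c n r x"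
    using sees_subset_swap_top[OF inj_swap y rank_swap] sees_self[OF y] by (auto simp: swap_swap)
qed

lemma sees_swap:
  assumes "g \<in> {1..n}" "g \<in> {x, y} \<Longrightarrow> y \<notin> sees c n r x"
  shows "sees c n (swap x y r) g = sees c n r g"
proof
  show "sees c n r g \<subseteq> sees c n (swap x y r) g"
    using assms by (intro sees_subset_swap[OF inj_r x y xy]) auto
  have "sees c n (swap x y r) g \<subseteq> sees c n (swap y x (swap x y r)) g"
    using assms sees_swap_iff by (intro sees_subset_swap[OF inj_swap y x rank_swap]) auto
  then show "sees c n (swap x y r) g \<subseteq> sees c n r g" by (simp add: swap_swap)
qed

lemma sees_swap_top:
  assumes "y \<in> sees c n r x"
  shows "sees c n (swap x y r) y = sees c n r x"
proof
  show "sees c n r x \<subseteq> sees c n (swap x y r) y" by (rule sees_subset_swap_top[OF inj_r x xy assms])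
  have "x \<in> sees c n (swap x y r) y" using sees_swap_iff assms by simp
  then have "sees c n (swap x y r) y \<subseteq> sees c n (swap y x (swap x y r)) x"
    by (rule sees_subset_swap_top[OF inj_swap y rank_swap])
  then show "sees c n (swap x y r) y \<subseteq> sees c n r x" by (simp add: swap_swap)
qed

text \<open>If \<open>x\<close> does not see \<open>y\<close>, the two consecutive cuts happen in
  different components and commute.\<close>

lemma Nest_swap:
  assumes "y \<notin> sees c n r x"
  shows "Nest c n (swap x y r) = Nest c n r"
  unfolding Nest_def using sees_swap assms by (intro image_cong) auto

text \<open>The old tube of \<open>x\<close> is the new tube of \<open>y\<close>, so the flip
  replaces just the old tube of \<open>y\<close> by the new tube of \<open>x\<close>. The vertex
  \<open>x\<close> belongs only to the new one, and a smaller vertex \<open>a\<close> only to the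
  old one.\<close>

lemma Nest_swap_flip:
  assumes s: "y \<in> sees c n r x" and less: "y < x"
  obtains A A' a a' where "A \<in> Nest c n r - Nest c n (swap x y r)" "A' \<in> Nest c n (swap x y r) - Nest c n r"
    "Nest c n r - {A} = Nest c n (swap x y r) - {A'}" "a \<in> A - A'" "a' \<in> A' - A" "a < a'"
proof -
  define t where "t g = verts c (sees c n r g)" for g
  define t' where "t' g = verts c (sees c n (swap x y r) g)" for g
  define M where "M = t ` ({1..n} - {x, y}) \<union> {t x}"
  have inj: "inj_on t {1..n}" "inj_on t' {1..n}"
    unfolding t_def t'_def using inj_on_verts_sees inj_r inj_swap by blast+
  have tt: "t' g = t g" if "g \<in> {1..n}" "g \<notin> {x, y}" for g
    unfolding t_def t'_def using sees_swap[OF that(1)] that by simp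
  have ty: "t' y = t x" unfolding t_def t'_def using sees_swap_top[OF s] by simp
  have N: "Nest c n r = insert (t y) M"
    unfolding Nest_def M_def t_def using x y by blast
  have "Nest c n (swap x y r) = insert (t' x) (t' ` ({1..n} - {x, y}) \<union> {t' y})"
    unfolding Nest_def t'_def using x y by blast
  also have "t' ` ({1..n} - {x, y}) = t ` ({1..n} - {x, y})"
    using tt by (intro image_cong) auto
  finally have N': "Nest c n (swap x y r) = insert (t' x) M" unfolding ty M_def .
  have "x \<noteq> y" using less by simp
  have ni: "t y \<notin> M" "t' x \<notin> M"
  proof -
    show "t y \<notin> M" unfolding M_def using inj_on_eq_iff[OF inj(1)] x y \<open>x \<noteq> y\<close> by auto
    show "t' x \<notin> M"
      unfolding M_def ty[symmetric] using tt inj_on_eq_iff[OF inj(2)] x y \<open>x \<noteq> y\<close> by force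
  qed
  have y': "y \<notin> sees c n (swap x y r) x" using sees_rank_le[of y c n "swap x y r" x] rank_swap by auto
  have x': "x \<notin> sees c n r y" using sees_rank_le[of x c n r y] xy by auto
  have pos: "1 \<le> h" if "h \<in> sees c n q e" for h q e using sees_subset that by fastforce
  have xv: "x \<in> t' x" and yv: "y \<in> t y" "par c y \<in> t y"
    unfolding t_def t'_def verts_def using sees_self x y by blast+
  \<comment> \<open>Otherwise \<open>x\<close> is the parent of an edge \<open>h\<close> seen by
    \<open>y\<close>, and the edge \<open>x\<close> lies between \<open>y\<close> and
    \<open>h\<close>, although its rank is lower than that of \<open>y\<close>.\<close>
  have xA: "x \<notin> t y"
  proof
    assume "x \<in> t y"
    then obtain h where h: "h \<in> sees c n r y" "x = par c h" using x' unfolding t_def verts_def by blast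
    then have "btw c y x h" using less pos[OF h(1)] unfolding par_def btw_def by linarith
    then show False using sees_btw[OF h(1)] x' y by blast
  qed
  \<comment> \<open>For a chain edge \<open>y\<close> the witness is its lower endpoint, which the
    new tube of \<open>x\<close> could reach only through \<open>y\<close>; for a leaf edge it is
    the leaf \<open>y\<close>.\<close>
  obtain a where a: "a \<in> t y - t' x" "a < x"
  proof (cases "y \<le> c")
    case True
    have "y - 1 \<notin> t' x"
    proof
      assume "y - 1 \<in> t' x"
      then obtain h where h: "h \<in> sees c n (swap x y r) x" "y - 1 = h \<or> y - 1 = par c h"
        unfolding t'_def verts_def by blast
      have "h \<noteq> y" using h y' by blast
      then have "h < y" using h(2) True pos[OF h(1)] y unfolding par_def by auto
      then have "btw c x y h" using less True by (auto simp: btw_def)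
      then show False using sees_btw[OF h(1)] x y' by blast
    qed
    moreover have "par c y = y - 1" using True by (auto simp: par_def)
    ultimately show ?thesis using that[of "y - 1"] yv less by auto
  next
    case False
    have "y \<notin> t' x" using y' False unfolding t'_def verts_def par_def by auto
    then show ?thesis using that yv less by blast
  qed
  have neq: "t y \<noteq> t' x" using a by auto
  show ?thesis
  proof (rule that[of "t y" "t' x" a x])
    show "t y \<in> Nest c n r - Nest c n (swap x y r)" "t' x \<in> Nest c n (swap x y r) - Nest c n r"
      "Nest c n r - {t y} = Nest c n (swap x y r) - {t' x}"
      unfolding N N' using ni neq by auto
  qed (use a xv xA in auto)
qed

end

section \<open>Inclusion of ascents gives a chain of flips\<close>

lemma strict_mono_self_map:
  fixes f :: "nat \<Rightarrow> nat"
  assumes "\<And>p. p \<in> {1..n} \<Longrightarrow> f p \<in> {1..n}" "\<And>p. 1 \<le> p \<Longrightarrow> p < n \<Longrightarrow> f p < f (Suc p)" "p \<in> {1..n}"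
  shows "f p = p"
proof (rule antisym)
  have "1 \<le> p" "p \<le> n" using assms(3) by auto
  show "p \<le> f p" using \<open>1 \<le> p\<close> \<open>p \<le> n\<close>
  proof (induction p rule: dec_induct)
    case base then show ?case using assms(1)[of 1] by auto
  next
    case (step m) then show ?case using assms(2)[of m] by auto
  qed
  have "f p \<le> p" if "p \<le> n" "1 \<le> p" using that
  proof (induction p rule: inc_induct)
    case base then show ?case using assms(1)[of n] by auto
  next
    case (step m) then show ?case using assms(2)[of m] by auto
  qed
  then show "f p \<le> p" using \<open>1 \<le> p\<close> \<open>p \<le> n\<close> by simp
qed

lemma Nest_cong: 
  assumes "\<And>e. e \<in> {1..n} \<Longrightarrow> r e = r' e"
  shows "Nest c n r = Nest c n r'"
proof -
  have "sees c n r e \<subseteq> sees c n r' e" 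
    if "e \<in> {1..n}" "\<And>e. e \<in> {1..n} \<Longrightarrow> r e = r' e" for e and r r' :: "nat \<Rightarrow> nat"
    using that btw_range[of c e _ _ n] unfolding sees_def by auto
  then have "sees c n r e = sees c n r' e" if "e \<in> {1..n}" for e
    using assms that by (metis subset_antisym)
  then show ?thesis unfolding Nest_def by (intro image_cong) auto
qed

text \<open>If every ascent of \<open>r'\<close> between consecutive ranks is also one of
  \<open>r\<close>, then \<open>r\<close> orders each consecutive pair as \<open>r'\<close> does;
  descents agree by inclusion. Hence \<open>r\<close> composed with the inverse of \<open>r'\<close>
  is an increasing self-map, the identity.\<close>

lemma ascents_chain_step:
  assumes r: "bij_betw r {1..n} {1..n}" and r': "bij_betw r' {1..n} {1..n}" and le: "ascents n r \<subseteq> ascents n r'"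
  shows "(\<forall>e\<in>{1..n}. r e = r' e) \<or>
    (\<exists>x\<in>{1..n}. \<exists>y\<in>{1..n}. x < y \<and> r' y = Suc (r' x) \<and> (x, y) \<notin> ascents n r)"
proof (rule disjCI)
  assume none: "\<not> (\<exists>x\<in>{1..n}. \<exists>y\<in>{1..n}. x < y \<and> r' y = Suc (r' x) \<and> (x, y) \<notin> ascents n r)"
  have less: "r x < r y" if xy: "x \<in> {1..n}" "y \<in> {1..n}" "r' y = Suc (r' x)" for x y
  proof -
    have "x \<noteq> y" using xy by auto
    then consider "x < y" | "y < x" by linarith
    then show ?thesis
    proof cases
      case 1 then show ?thesis using none xy unfolding ascents_def by auto
    next
      case 2
      have "(y, x) \<notin> ascents n r" using subsetD[OF le, of "(y, x)"] xy by (auto simp: ascents_def)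
      then have "\<not> r y < r x" using 2 xy by (auto simp: ascents_def)
      moreover have "r x \<noteq> r y" using inj_on_eq_iff[OF bij_betw_imp_inj_on[OF r] xy(1,2)] \<open>x \<noteq> y\<close> by simp
      ultimately show ?thesis by simp
    qed
  qed
  define s where "s = inv_into {1..n} r'"
  have s: "s p \<in> {1..n}" "r' (s p) = p" if "p \<in> {1..n}" for p
    using bij_betwE[OF bij_betw_inv_into[OF r']] bij_betw_inv_into_right[OF r'] that unfolding s_def by blast+
  have "r (s p) = p" if "p \<in> {1..n}" for p
  proof (rule strict_mono_self_map[OF _ _ that])
    show "r (s p) \<in> {1..n}" if "p \<in> {1..n}" for p using s(1)[OF that] bij_betwE[OF r] by blast
    show "r (s p) < r (s (Suc p))" if "1 \<le> p" "p < n" for p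
      using that s[of p] s[of "Suc p"] by (intro less) auto
  qed
  moreover have "s (r' e) = e" "r' e \<in> {1..n}" if "e \<in> {1..n}" for e
    using bij_betw_inv_into_left[OF r'] bij_betwE[OF r'] that unfolding s_def by blast+
  ultimately show "\<forall>e\<in>{1..n}. r e = r' e" by metis
qed

text \<open>Descend from \<open>r'\<close> by undoing ascents between consecutive ranks that
  \<open>r\<close> lacks; each such swap fixes the nesting or undoes an upward flip.\<close>

lemma MN_le_Nest:
  assumes k: "1 \<le> k" "k \<le> n" and r: "bij_betw r {1..n} {1..n}" and r': "bij_betw r' {1..n} {1..n}"
    and le: "ascents n r \<subseteq> ascents n r'"
  shows "MN_le (broom k n) (Nest (n - k) n r) (Nest (n - k) n r')"
  using r' le
proof (induction "card (ascents n r')" arbitrary: r' rule: less_induct)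
  case less
  consider "\<forall>e\<in>{1..n}. r e = r' e" |
    x y where "x \<in> {1..n}" "y \<in> {1..n}" "x < y" "r' y = Suc (r' x)" "(x, y) \<notin> ascents n r"
    using ascents_chain_step[OF r less.prems] by blast
  then show ?case
  proof cases
    case 1
    then have "Nest (n - k) n r = Nest (n - k) n r'" by (intro Nest_cong) auto
    then show ?thesis by (simp add: MN_le_def)
  next
    case 2
    let ?q = "swap x y r'"
    have q: "bij_betw ?q {1..n} {1..n}" using bij_betw_swap less.prems(1) 2 by blast
    have A: "ascents n ?q = ascents n r' - {(x, y)}"
      using ascents_swap[OF bij_betw_imp_inj_on[OF less.prems(1)] 2(1,2,4,3)] .
    have "(x, y) \<in> ascents n r'" using 2 by (auto simp: ascents_def)
    then have "card (ascents n ?q) < card (ascents n r')"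
      unfolding A using finite_ascents by (metis card_Diff1_less)
    moreover have "ascents n r \<subseteq> ascents n ?q" using A less.prems(2) 2(5) by blast
    ultimately have "MN_le (broom k n) (Nest (n - k) n r) (Nest (n - k) n ?q)"
      using less.hyps q by blast
    moreover have "MN_le (broom k n) (Nest (n - k) n ?q) (Nest (n - k) n r')"
    proof -
      \<comment> \<open>The swap lemmas are applied to the step from \<open>?q\<close> up to
        \<open>r'\<close>, with \<open>x\<close> and \<open>y\<close> in exchanged roles.\<close>
      have q1: "?q x = Suc (?q y)" using 2 by (simp add: swap_simps)
      have sw: "swap y x ?q = r'" by (rule swap_swap)
      show ?thesis
      proof (cases "x \<in> sees (n - k) n ?q y")
        case False
        then show ?thesis using Nest_swap[OF q 2(2,1) q1] by (simp add: sw MN_le_def)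
      next
        case True
        have "Nest (n - k) n ?q \<in> MN (broom k n)" "Nest (n - k) n r' \<in> MN (broom k n)"
          unfolding MN_broom[OF k] using q less.prems(1) by auto
        moreover obtain A A' a a' where "A \<in> Nest (n - k) n ?q - Nest (n - k) n r'"
          "A' \<in> Nest (n - k) n r' - Nest (n - k) n ?q"
          "Nest (n - k) n ?q - {A} = Nest (n - k) n r' - {A'}" "a \<in> A - A'" "a' \<in> A' - A" "a < a'"
          using Nest_swap_flip[OF q 2(2,1) q1 True 2(3)] unfolding sw by metis
        ultimately have "MN_less (broom k n) (Nest (n - k) n ?q) (Nest (n - k) n r')"
          unfolding MN_less_def by blast
        then show ?thesis by (simp add: MN_le_def)
      qed
    qed
    ultimately show ?thesis unfolding MN_le_def by (rule rtranclp_trans)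
  qed
qed

section \<open>Canonical rankings\<close>

text \<open>Avoidance of the pattern 213 with its middle position on the chain. In such a pattern
  the tubes of \<open>x\<close> and \<open>y\<close> lie on opposite sides of \<open>m\<close>, so
  neither contains the other.\<close>

definition canonical :: "nat \<Rightarrow> nat \<Rightarrow> (nat \<Rightarrow> nat) \<Rightarrow> bool" where
  "canonical c n r \<longleftrightarrow> \<not> (\<exists>x\<in>{1..n}. \<exists>y\<in>{1..n}. \<exists>m\<le>c. x < m \<and> m < y \<and> r m < r x \<and> r x < r y)"

text \<open>A forbidden pattern yields an ascent of consecutive ranks across the earlier cut
  \<open>m\<close>; swapping it keeps the nesting and removes one ascent.\<close>

lemma exists_canonical:
  assumes "bij_betw r {1..n} {1..n}"
  shows "\<exists>r'. bij_betw r' {1..n} {1..n} \<and> canonical c n r' \<and> Nest c n r' = Nest c n r"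
  using assms
proof (induction "card (ascents n r)" arbitrary: r rule: less_induct)
  case less
  show ?case
  proof (cases "canonical c n r")
    case True
    then show ?thesis using less.prems by blast
  next
    case False
    then obtain x m y where x: "x \<in> {1..n}" "y \<in> {1..n}" "m \<le> c" "x < m" "m < y" "r m < r x" "r x < r y"
      unfolding canonical_def by blast
    define s where "s = inv_into {1..n} r"
    have s: "s p \<in> {1..n}" "r (s p) = p" if "p \<in> {1..n}" for p
      using bij_betwE[OF bij_betw_inv_into[OF less.prems]] bij_betw_inv_into_right[OF less.prems] that unfolding s_def by blast+
    have sr: "s (r e) = e" "r e \<in> {1..n}" if "e \<in> {1..n}" for e
      using bij_betw_inv_into_left[OF less.prems] bij_betwE[OF less.prems] that unfolding s_def by blast+
    \<comment> \<open>As the rank runs from \<open>r x\<close> to \<open>r y\<close>, the edge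
      carrying it starts below \<open>m\<close> and ends above \<open>m\<close>, so at some step it
      jumps over \<open>m\<close>.\<close>
    have "\<exists>p. r x \<le> p \<and> p < r y \<and> s p < m \<and> \<not> s (Suc p) < m"
    proof (rule ccontr)
      assume none: "\<not> ?thesis"
      have "s (r y) < m" using less_imp_le[OF x(7)]
      proof (induction rule: dec_induct)
        case base then show ?case using sr(1)[OF x(1)] x by simp
      next
        case (step q) then show ?case using none by blast
      qed
      then show False using sr(1)[OF x(2)] x by simp
    qed
    then obtain p where p: "r x \<le> p" "p < r y" "s p < m" "\<not> s (Suc p) < m" by blast
    define u v where "u = s p" and "v = s (Suc p)"
    have pn: "p \<in> {1..n}" "Suc p \<in> {1..n}" using p sr(2)[OF x(1)] sr(2)[OF x(2)] by auto
    have uv: "u \<in> {1..n}" "v \<in> {1..n}" "r u = p" "r v = Suc p" using s[OF pn(1)] s[OF pn(2)] by (simp_all add: u_def v_def)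
    have "v \<noteq> m" using uv p x by auto
    then have b: "u < m" "m < v" using p by (auto simp: u_def v_def)
    then have "btw c u m v" using x by (simp add: btw_def)
    moreover have "r m < r u" using uv p x by simp
    ultimately have "v \<notin> sees c n r u" unfolding sees_def by auto
    then have N: "Nest c n (swap u v r) = Nest c n r" using Nest_swap[OF less.prems uv(1,2)] uv by simp
    have "ascents n (swap u v r) = ascents n r - {(u, v)}"
      using ascents_swap[OF bij_betw_imp_inj_on[OF less.prems] uv(1,2)] uv b by simp
    moreover have "(u, v) \<in> ascents n r" using uv b by (auto simp: ascents_def)
    ultimately have "card (ascents n (swap u v r)) < card (ascents n r)"
      using finite_ascents by (metis card_Diff1_less)
    then show ?thesis using less.hyps[OF _ bij_betw_swap[OF less.prems uv(1,2)]] N by simp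
  qed
qed

text \<open>The tube of \<open>e\<close> is the smallest tube through \<open>e\<close>, so
  visibility depends on the nesting alone.\<close>

lemma sees_iff_Nest:
  assumes "inj_on r {1..n}" "e \<in> {1..n}"
  shows "f \<in> sees c n r e \<longleftrightarrow> (\<forall>A\<in>Nest c n r. e \<in> edges c A \<longrightarrow> f \<in> edges c A)"
proof
  assume f: "f \<in> sees c n r e"
  show "\<forall>A\<in>Nest c n r. e \<in> edges c A \<longrightarrow> f \<in> edges c A"
  proof (intro ballI impI)
    fix A assume "A \<in> Nest c n r" "e \<in> edges c A"
    then obtain g where g: "g \<in> {1..n}" "A = verts c (sees c n r g)" "e \<in> edges c A"
      unfolding Nest_def by blast
    then have "e \<in> sees c n r g" using edges_verts_sees by blast
    then show "f \<in> edges c A" using sees_trans[OF assms(1) g(1) _ f] edges_verts_sees g by blast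
  qed
next
  assume "\<forall>A\<in>Nest c n r. e \<in> edges c A \<longrightarrow> f \<in> edges c A"
  then show "f \<in> sees c n r e"
    using edges_verts_sees[OF assms(2)] sees_self[OF assms(2)] assms(2) unfolding Nest_def by blast
qed

text \<open>Canonicity forbids an edge of lower rank between the two ends of an ascent, which is all
  that could obstruct visibility.\<close>

lemma canonical_ascents_iff:
  assumes r: "inj_on r {1..n}" and P: "canonical c n r" and "e \<in> {1..n}" "f \<in> {1..n}"
  shows "(e, f) \<in> ascents n r \<longleftrightarrow> e < f \<and> f \<in> sees c n r e"
proof
  assume "(e, f) \<in> ascents n r"
  then have ef: "e < f" "r e < r f" by (auto simp: ascents_def)
  have "r e < r m" if m: "btw c e m f" for m
  proof -
    have "m \<in> {1..n}" "e < m" "m < f" "m \<le> c" using btw_range[OF m assms(3,4)] m ef(1) by (auto simp: btw_def)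
    then have "\<not> r m < r e" using P assms(3,4) ef unfolding canonical_def by blast
    moreover have "r m \<noteq> r e"
      using inj_on_eq_iff[OF r \<open>m \<in> {1..n}\<close> assms(3)] \<open>e < m\<close> by simp
    ultimately show ?thesis by simp
  qed
  then show "e < f \<and> f \<in> sees c n r e" using ef assms by (simp add: sees_def)
next
  assume "e < f \<and> f \<in> sees c n r e"
  then show "(e, f) \<in> ascents n r" using sees_rank_less[OF r assms(3)] assms by (auto simp: ascents_def)
qed

lemma Nest_eq_imp_ascents_eq:
  assumes "inj_on r {1..n}" "inj_on r' {1..n}" "canonical c n r" "canonical c n r'" "Nest c n r = Nest c n r'"
  shows "ascents n r = ascents n r'"
proof -
  have "(e, f) \<in> ascents n r \<longleftrightarrow> (e, f) \<in> ascents n r'" if "e \<in> {1..n}" "f \<in> {1..n}" for e f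
    using canonical_ascents_iff[OF assms(1,3) that] canonical_ascents_iff[OF assms(2,4) that]
      sees_iff_Nest[OF assms(1) that(1)] sees_iff_Nest[OF assms(2) that(1)] assms(5) by simp
  then show ?thesis unfolding ascents_def by blast
qed

section \<open>Flips upwards only add ascents\<close>

text \<open>If \<open>i\<close> no longer sees \<open>j\<close>, then \<open>A'\<close> is the new
  tube of \<open>i\<close> and \<open>A\<close> the old tube of the first edge \<open>e\<close>
  outside \<open>A'\<close> on the way to \<open>j\<close>. Edges only in \<open>A\<close> are at
  least \<open>e\<close>, edges only in \<open>A'\<close> at most \<open>i\<close>, and
  \<open>i < e\<close> contradicts an upward flip.\<close>

lemma ascents_flip:
  assumes r: "inj_on r {1..n}" and r': "inj_on r' {1..n}" and P: "canonical c n r"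
    and A: "A \<in> Nest c n r" and A': "A' \<in> Nest c n r'"
    and eq: "Nest c n r - {A} = Nest c n r' - {A'}" and n: "1 \<le> n"
    and a: "a \<in> A - A'" "a' \<in> A' - A" "a < a'"
  shows "ascents n r \<subseteq> ascents n r'"
proof clarify
  fix i j assume asc: "(i, j) \<in> ascents n r"
  then have ij: "i \<in> {1..n}" "j \<in> {1..n}" "i < j" by (auto simp: ascents_def)
  let ?S = "sees c n r" and ?S' = "sees c n r'" and ?t = "\<lambda>e. verts c (sees c n r e)"
    and ?t' = "\<lambda>e. verts c (sees c n r' e)"
  have jS: "j \<in> ?S i" using canonical_ascents_iff[OF r P ij(1,2)] asc by simp
  have up: "?S e \<subseteq> edges c B" if "B \<in> Nest c n r" "e \<in> edges c B" "e \<in> {1..n}" for B e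
    using sees_iff_Nest[OF r that(3)] that by blast
  have up': "?S' e \<subseteq> edges c B" if "B \<in> Nest c n r'" "e \<in> edges c B" "e \<in> {1..n}" for B e
    using sees_iff_Nest[OF r' that(3)] that by blast
  have tN: "?t e \<in> Nest c n r" "?t' e \<in> Nest c n r'" if "e \<in> {1..n}" for e
    using that unfolding Nest_def by blast+
  have ed: "edges c (?t e) = ?S e" "edges c (?t' e) = ?S' e" if "e \<in> {1..n}" for e
    using edges_verts_sees that by blast+
  have inN': "B \<in> Nest c n r'" if "B \<in> Nest c n r" "B \<noteq> A" for B
    using eq that by blast
  have inN: "B \<in> Nest c n r" if "B \<in> Nest c n r'" "B \<noteq> A'" for B
    using eq that by blast
  have EN: "edge_nesting c n (Nest c n r)" "edge_nesting c n (Nest c n r')"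
    using edge_nesting_Nest n r r' by blast+
  have "j \<in> ?S' i"
  proof (rule ccontr)
    assume njS: "j \<notin> ?S' i"
    have A'i: "?t' i = A'"
    proof (rule ccontr)
      assume "?t' i \<noteq> A'"
      then have "?t' i \<in> Nest c n r" by (rule inN[OF tN(2)[OF ij(1)]])
      then show False using up[of "?t' i" i] ed[OF ij(1)] sees_self[OF ij(1)] ij(1) jS njS by blast
    qed
    \<comment> \<open>The new tube of a boundary edge \<open>g\<close> strictly contains
      \<open>A'\<close>, so it is also an old tube and contains all of \<open>?S i\<close>. Were the
      old tube of \<open>g\<close> kept, it would contain \<open>i\<close>, and \<open>i\<close> and
      \<open>g\<close> would see each other.\<close>
    have U: "?t g = A \<and> ?S i \<subseteq> ?S' g"
      if g: "g \<in> ?S i" "g \<notin> ?S' i" "g \<in> ?t' i \<or> par c g \<in> ?t' i" for g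
    proof -
      have gn: "g \<in> {1..n}" using g sees_subset by blast
      have "?t' i \<subset> ?t' g"
        by (rule edge_nesting_touching[OF EN(2) tN(2)[OF ij(1)] tN(2)[OF gn], of g])
          (use ed(2)[OF gn] ed(2)[OF ij(1)] g sees_self[OF gn] in simp_all)
      then have "?t' g \<noteq> A'" "?S' i \<subseteq> ?S' g" using A'i edges_mono[of "?t' i" "?t' g" c] ed[OF gn] ed[OF ij(1)] by auto
      then have "?t' g \<in> Nest c n r" "i \<in> ?S' g" using inN[OF tN(2)[OF gn]] sees_self[OF ij(1)] by blast+
      then have sub: "?S i \<subseteq> ?S' g" using up[of "?t' g" i] ed[OF gn] ij(1) by blast
      moreover have "?t g = A"
      proof (rule ccontr)
        assume "?t g \<noteq> A"
        then have "?t g \<in> Nest c n r'" by (rule inN'[OF tN(1)[OF gn]])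
        then have "?S' g \<subseteq> ?S g" using up'[of "?t g" g] ed[OF gn] sees_self[OF gn] gn by blast
        then have "i \<in> ?S g" using sub sees_self[OF ij(1)] by blast
        then have "i = g" using sees_antisym[OF r ij(1) g(1)] by simp
        then show False using g sees_self[OF ij(1)] by blast
      qed
      ultimately show ?thesis by blast
    qed
    have nearest: "\<exists>g\<in>?S i. g \<notin> T \<and> (g \<in> verts c T \<or> par c g \<in> verts c T) \<and> (g = y \<or> btw c x g y)"
      if "x \<in> ?S i" "y \<in> ?S i" "x \<in> T" "y \<notin> T" for x y T
      using exists_nearest_edge[OF conv_sees[OF ij(1)] sees_subset that] by metis
    have iS: "i \<in> ?S i" "i \<in> ?S' i" using sees_self ij(1) by blast+
    obtain e where e: "e \<in> ?S i" "e \<notin> ?S' i" "e \<in> ?t' i \<or> par c e \<in> ?t' i" "e = j \<or> btw c i e j"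
      using nearest[OF iS(1) jS iS(2) njS] by blast
    have en: "e \<in> {1..n}" and ie: "i < e" using e ij sees_subset by (blast, auto simp: btw_def)
    have te: "?t e = A" "?S i \<subseteq> ?S' e" using U[OF e(1-3)] by blast+
    have eS: "e \<in> ?S e" using sees_self en by blast
    have "?t i \<noteq> ?t e" using inj_on_eq_iff[OF inj_on_verts_sees[OF r] ij(1) en] ie by simp
    then have "?t i \<in> Nest c n r'" unfolding te(1) by (rule inN'[OF tN(1)[OF ij(1)]])
    then have S'i: "?S' i \<subseteq> ?S i" using up'[OF _ _ ij(1)] ed(1)[OF ij(1)] iS(1) by metis
    \<comment> \<open>The old tube of a boundary edge \<open>h\<close> of \<open>A\<close> strictly
      contains \<open>A\<close>, so it survives the flip and contains the new component of
      \<open>e\<close>, hence \<open>i\<close>.\<close>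
    have U': "h = i" if h: "h \<in> ?S i" "h \<notin> ?S e" "h \<in> ?t e \<or> par c h \<in> ?t e" for h
    proof -
      have hn: "h \<in> {1..n}" using h sees_subset by blast
      have sub: "?t e \<subset> ?t h"
        by (rule edge_nesting_touching[OF EN(1) tN(1)[OF en] tN(1)[OF hn], of h])
          (use ed(1)[OF hn] ed(1)[OF en] h sees_self[OF hn] in simp_all)
      then have "?t h \<in> Nest c n r'" using inN'[OF tN(1)[OF hn]] te(1) by blast
      moreover have "e \<in> ?S h" using edges_mono[of "?t e" "?t h" c] sub ed[OF hn] ed[OF en] eS by blast
      ultimately have "?S' e \<subseteq> ?S h" using up'[OF _ _ en] ed(1)[OF hn] by metis
      then have "i \<in> ?S h" using te iS by blast
      then show "h = i" using sees_antisym[OF r ij(1) h(1)] by simp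
    qed
    have high: "e \<le> x" if x: "x \<in> ?S e" "x \<notin> ?S' i" for x
    proof -
      have "x \<in> ?S i" using sees_trans[OF r ij(1) e(1) x(1)] .
      then obtain g where g: "g \<in> ?S i" "g \<notin> ?S' i" "g \<in> ?t' i \<or> par c g \<in> ?t' i" "g = x \<or> btw c i g x"
        using nearest[OF iS(1) _ iS(2) x(2)] by blast
      then have "?t g = ?t e" using U[OF g(1-3)] te by simp
      moreover have "g \<in> {1..n}" using g(1) sees_subset by blast
      ultimately have "g = e" using inj_on_eq_iff[OF inj_on_verts_sees[OF r] _ en] by blast
      then show ?thesis using g(4) ie by (auto simp: btw_def)
    qed
    have low: "y \<le> i" if y: "y \<in> ?S' i" "y \<notin> ?S e" for y
    proof -
      have "y \<in> ?S i" using y S'i by blast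
      then obtain g where g: "g \<in> ?S i" "g \<notin> ?S e" "g \<in> ?t e \<or> par c g \<in> ?t e" "g = y \<or> btw c e g y"
        using nearest[OF e(1) _ eS y(2)] by blast
      then have "g = i" using U' by blast
      then show ?thesis using g(4) ie by (auto simp: btw_def)
    qed
    obtain x where x: "x \<in> ?S e" "a = x \<or> a = par c x" "x \<notin> ?S' i"
      using a(1) te(1) A'i unfolding verts_def by blast
    obtain y where y: "y \<in> ?S' i" "a' = y \<or> a' = par c y" "y \<notin> ?S e"
      using a(2) te(1) A'i unfolding verts_def by blast
    have "a' \<le> i" using low[OF y(1,3)] y(2) by (auto simp: par_def)
    moreover have "e \<le> x" using high x by blast
    \<comment> \<open>The labels bound edges, while \<open>a\<close> may be a lower endpoint. The
      one remaining case is \<open>a = c\<close> with \<open>i\<close> a leaf edge, but then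
      \<open>a\<close> is an endpoint of \<open>i\<close> and lies in \<open>A'\<close>.\<close>
    ultimately have "a = c" "c < i" using x(2) ie a(3) unfolding par_def by linarith+
    then have "a = par c i" by (auto simp: par_def)
    then show False using a(1) A'i iS(2) unfolding verts_def by blast
  qed
  then show "(i, j) \<in> ascents n r'" using sees_rank_less[OF r' ij(1)] ij by (auto simp: ascents_def)
qed

text \<open>Represent each nesting of the chain by a canonical ranking and compare ascents flip by
  flip; \<open>q\<close> is kept general because a nesting has to fix the ascents of any canonical
  representative.\<close>

lemma MN_le_imp_ascents_subset:
  assumes k: "1 \<le> k" "k \<le> n" and r: "bij_betw r {1..n} {1..n}" "canonical (n - k) n r"
    and r': "bij_betw r' {1..n} {1..n}" "canonical (n - k) n r'"
    and le: "MN_le (broom k n) (Nest (n - k) n r) (Nest (n - k) n r')"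
  shows "ascents n r \<subseteq> ascents n r'"
proof -
  have "ascents n r \<subseteq> ascents n q"
    if "(MN_less (broom k n))\<^sup>*\<^sup>* (Nest (n - k) n r) N" "N = Nest (n - k) n q" "bij_betw q {1..n} {1..n}"
      "canonical (n - k) n q" for N q
    using that
  proof (induction arbitrary: q rule: rtranclp_induct)
    case base
    then show ?case using Nest_eq_imp_ascents_eq[OF bij_betw_imp_inj_on[OF r(1)] bij_betw_imp_inj_on[OF base(2)] r(2) base(3,1)]
      by simp
  next
    case (step N1 N2)
    obtain p where "bij_betw p {1..n} {1..n}" "N1 = Nest (n - k) n p"
      using step.hyps(2) MN_broom[OF k] unfolding MN_less_def by auto
    then obtain p where p: "bij_betw p {1..n} {1..n}" "N1 = Nest (n - k) n p" "canonical (n - k) n p"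
      using exists_canonical[of _ n "n - k"] by metis
    obtain A A' a a' where "A \<in> N1 - N2" "A' \<in> N2 - N1" "N1 - {A} = N2 - {A'}" "a \<in> A - A'" "a' \<in> A' - A" "a < a'"
      using step.hyps(2) unfolding MN_less_def by (elim conjE bexE) (rule that)
    note A = this[unfolded p(2) step.prems(1)]
    have "ascents n p \<subseteq> ascents n q"
      using k by (intro ascents_flip[OF bij_betw_imp_inj_on[OF p(1)]
          bij_betw_imp_inj_on[OF step.prems(2)] p(3) DiffD1[OF A(1)] DiffD1[OF A(2)] A(3) _ A(4,5,6)]) simp
    then show ?case using step.IH[OF p(2,1,3)] by blast
  qed
  then show ?thesis using le r' unfolding MN_le_def by blast
qed

section \<open>Stack-sorting\<close>

fun precedes :: "'a \<Rightarrow> 'a \<Rightarrow> 'a list \<Rightarrow> bool" where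
  "precedes a b [] \<longleftrightarrow> False"
| "precedes a b (x # xs) \<longleftrightarrow> a = x \<and> b \<in> set xs \<or> precedes a b xs"

lemma precedes_append:
  "precedes a b (xs @ ys) \<longleftrightarrow> precedes a b xs \<or> precedes a b ys \<or> a \<in> set xs \<and> b \<in> set ys"
  by (induction xs) auto

lemma precedes_in_set: "precedes a b xs \<Longrightarrow> a \<in> set xs \<and> b \<in> set xs"
  by (induction xs) auto

lemma precedes_iff_nth:
  "precedes a b xs \<longleftrightarrow> (\<exists>j<length xs. \<exists>i<j. xs ! i = a \<and> xs ! j = b)"
proof (induction xs)
  case (Cons x xs)
  show ?case
    by (auto simp: Cons.IH in_set_conv_nth less_Suc_eq_0_disj)
      (metis Suc_less_eq nth_Cons_Suc zero_less_Suc nth_Cons_0)+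
qed simp

text \<open>Split at the maximum \<open>m\<close>. If \<open>y\<close> stands to its left and
  \<open>x\<close> to its right, then \<open>z = m\<close> is a witness; if both stand on the same
  side, so does any witness, and induction applies.\<close>

lemma precedes_stack_sort_iff:
  assumes "distinct xs" "x < y"
  shows "precedes y x (stack_sort xs) \<longleftrightarrow> (\<exists>z>y. precedes y z xs \<and> precedes z x xs)"
  using assms(1)
proof (induction xs rule: length_induct)
  case (1 xs)
  show ?case
  proof (cases "xs = []")
    case True
    then show ?thesis by (simp add: stack_sort_Nil)
  next
    case False
    define m where "m = Max (set xs)"
    have "m \<in> set xs" using False by (simp add: m_def)
    then obtain L R where xs: "xs = L @ m # R" by (meson split_list)
    have max: "z \<le> m" if "z \<in> set xs" for z using that by (simp add: m_def)
    have d: "distinct L" "distinct R" "m \<notin> set L" "m \<notin> set R" "set L \<inter> set R = {}"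
      using 1(2) xs by auto
    have less: "\<forall>z\<in>set L \<union> set R. z < m" using max d xs by (auto simp: order.strict_iff_order)
    have L: "precedes y x (stack_sort L) \<longleftrightarrow> (\<exists>z>y. precedes y z L \<and> precedes z x L)"
      and R: "precedes y x (stack_sort R) \<longleftrightarrow> (\<exists>z>y. precedes y z R \<and> precedes z x R)"
      using 1(1) d xs by auto
    have set: "set (stack_sort zs) = set zs" for zs using mset_stack_sort mset_eq_setD by blast
    have s: "precedes y x (stack_sort xs) \<longleftrightarrow>
        precedes y x (stack_sort L) \<or> precedes y x (stack_sort R) \<or> y \<in> set L \<and> x \<in> set R"
    proof -
      have "x \<noteq> m" if "y \<in> set L \<union> set R" using bspec[OF less that] assms(2) by auto
      then show ?thesis
        unfolding xs stack_sort_rec[OF less] by (auto simp: precedes_append set)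
    qed
    show ?thesis
    proof
      assume "precedes y x (stack_sort xs)"
      then consider z where "z > y" "precedes y z L" "precedes z x L"
        | z where "z > y" "precedes y z R" "precedes z x R" | "y \<in> set L" "x \<in> set R"
        unfolding s L R by blast
      then show "\<exists>z>y. precedes y z xs \<and> precedes z x xs"
        unfolding xs using less by cases (auto simp: precedes_append)
    next
      assume "\<exists>z>y. precedes y z xs \<and> precedes z x xs"
      then obtain z where z: "z > y" "precedes y z xs" "precedes z x xs" by blast
      then have "y \<noteq> m" and "x \<noteq> m"
        using max[of z] max[of y] precedes_in_set[of y z xs] assms(2) by auto
      have yz: "precedes y z L \<or> y \<in> set L \<and> (z = m \<or> z \<in> set R) \<or> precedes y z R"
        using z(2) \<open>y \<noteq> m\<close> unfolding xs by (auto simp: precedes_append)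
      have zx: "precedes z x L \<or> (z \<in> set L \<or> z = m) \<and> x \<in> set R \<or> precedes z x R"
        using z(3) \<open>x \<noteq> m\<close> unfolding xs by (auto simp: precedes_append)
      consider "y \<in> set L" "x \<in> set R" | "precedes y z L" "precedes z x L"
        | "precedes y z R" "precedes z x R"
        using yz zx d(3,4,5) precedes_in_set[of y z L] precedes_in_set[of y z R]
          precedes_in_set[of z x L] precedes_in_set[of z x R] by blast
      then show "precedes y x (stack_sort xs)" unfolding s L R using z(1) by cases blast+
    qed
  qed
qed

lemma precedes_one_line_iff:
  assumes w: "w permutes {1..n}" and ab: "a \<in> {1..n}" "b \<in> {1..n}"
  shows "precedes a b (one_line n w) \<longleftrightarrow> inv w a < inv w b"
proof -
  have nth: "one_line n w ! i = w (Suc i)" if "i < n" for i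
    using that by (simp add: one_line_def del: upt_Suc)
  have len: "length (one_line n w) = n" by (simp add: one_line_def)
  show ?thesis
  proof
    assume "precedes a b (one_line n w)"
    then obtain i j where "i < j" "j < n" "w (Suc i) = a" "w (Suc j) = b"
      unfolding precedes_iff_nth len using nth by (metis less_trans)
    then show "inv w a < inv w b" using permutes_inverses(2)[OF w] by auto
  next
    assume less: "inv w a < inv w b"
    have "inv w a \<in> {1..n}" "inv w b \<in> {1..n}"
      using ab permutes_in_image[OF permutes_inv[OF w]] by simp_all
    moreover from this have "w (Suc (inv w a - 1)) = a" "w (Suc (inv w b - 1)) = b"
      using permutes_inverses(1)[OF w] by simp_all
    ultimately show "precedes a b (one_line n w)"
      unfolding precedes_iff_nth len using less nth
      by (intro exI[of _ "inv w b - 1"] conjI exI[of _ "inv w a - 1"]) auto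
  qed
qed

lemma Inversions_stack_sort_perm:
  assumes w: "w permutes {1..n}"
  shows "(i, j) \<in> Inversions n (stack_sort_perm n w) \<longleftrightarrow>
    i \<in> {1..n} \<and> j \<in> {1..n} \<and> i < j \<and> (\<exists>z\<in>{1..n}. j < z \<and> inv w j < inv w z \<and> inv w z < inv w i)"
proof (cases "i \<in> {1..n} \<and> j \<in> {1..n} \<and> i < j")
  case True
  have dist: "distinct (one_line n w)" and set: "set (one_line n w) = {1..n}"
  proof -
    have "set [1..<Suc n] = {1..n}" by auto
    then show "distinct (one_line n w)" "set (one_line n w) = {1..n}"
      using permutes_image[OF w] permutes_inj_on[OF w]
      unfolding one_line_def distinct_map by (simp_all only: set_map distinct_upt)
  qed
  have "(i, j) \<in> Inversions n (stack_sort_perm n w) \<longleftrightarrow> precedes j i (stack_sort (one_line n w))"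
    using precedes_one_line_iff[OF stack_sort_perm_permutes[OF w], of j i] True
    by (auto simp: Inversions_def one_line_stack_sort_perm)
  also have "\<dots> \<longleftrightarrow> (\<exists>z>j. precedes j z (one_line n w) \<and> precedes z i (one_line n w))"
    using precedes_stack_sort_iff[OF dist] True by blast
  also have "\<dots> \<longleftrightarrow> (\<exists>z\<in>{1..n}. j < z \<and> precedes j z (one_line n w) \<and> precedes z i (one_line n w))"
    using precedes_in_set set by metis
  also have "\<dots> \<longleftrightarrow> (\<exists>z\<in>{1..n}. j < z \<and> inv w j < inv w z \<and> inv w z < inv w i)"
    using precedes_one_line_iff[OF w] True by (intro bex_cong) auto
  finally show ?thesis using True by blast
qed (auto simp: Inversions_def)

lemma Inversions_w_circ:
  assumes "k \<le> n"
  shows "Inversions n (w_circ k n) = {(i, j). 1 \<le> i \<and> i < j \<and> j \<le> k}"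
proof -
  have "w_circ k n \<circ> w_circ k n = id" by (rule ext) (auto simp: w_circ_def)
  then have "inv (w_circ k n) = w_circ k n" using inv_unique_comp by blast
  then show ?thesis using assms by (auto simp: Inversions_def w_circ_def split: if_splits)
qed

text \<open>The inversions of \<open>w_circ k n\<close> are all pairs within \<open>{1..k}\<close>,
  so lying below it only bounds the larger letter \<open>j\<close> of an inversion by
  \<open>k\<close>.\<close>

lemma weak_ideal_w_circ_iff:
  assumes w: "w permutes {1..n}" and k: "k \<le> n"
  shows "stack_sort_perm n w \<in> weak_ideal n (w_circ k n) \<longleftrightarrow>
    \<not> (\<exists>i\<in>{1..n}. \<exists>j\<in>{1..n}. \<exists>z\<in>{1..n}. i < j \<and> j < z \<and> k < j \<and> inv w j < inv w z \<and> inv w z < inv w i)"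
proof -
  have "stack_sort_perm n w \<in> weak_ideal n (w_circ k n) \<longleftrightarrow>
      (\<forall>i j. (i, j) \<in> Inversions n (stack_sort_perm n w) \<longrightarrow> 1 \<le> i \<and> i < j \<and> j \<le> k)"
    using stack_sort_perm_permutes[OF w]
    by (auto simp: weak_ideal_def weak_le_def Inversions_w_circ[OF k])
  also have "\<dots> \<longleftrightarrow> (\<forall>i j. (i, j) \<in> Inversions n (stack_sort_perm n w) \<longrightarrow> \<not> k < j)"
    unfolding not_less by (auto simp: Inversions_def)
  finally show ?thesis unfolding Inversions_stack_sort_perm[OF w] by blast
qed

section \<open>The isomorphism\<close>

text \<open>The position of the letter \<open>n + 1 - e\<close> in \<open>w\<close>; the reflection
  matches chain edges with letters above \<open>k\<close> and ascents with inversions.\<close>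

definition edge_rank :: "nat \<Rightarrow> (nat \<Rightarrow> nat) \<Rightarrow> nat \<Rightarrow> nat" where
  "edge_rank n w e = inv w (n + 1 - e)"

lemma bij_betw_reflect: "bij_betw (\<lambda>e. n + 1 - e) {1..n} {1..n::nat}"
  by (rule bij_betw_byWitness[where f' = "\<lambda>e. n + 1 - e"]) auto

lemma bij_betw_edge_rank:
  assumes "w permutes {1..n}"
  shows "bij_betw (edge_rank n w) {1..n} {1..n}"
proof -
  have "edge_rank n w = inv w \<circ> (\<lambda>e. n + 1 - e)" by (auto simp: edge_rank_def)
  then show ?thesis
    using bij_betw_trans[OF bij_betw_reflect permutes_imp_bij[OF permutes_inv[OF assms]]] by simp
qed

lemma ball_reflect: "(\<forall>e\<in>{1..n::nat}. P (n + 1 - e)) \<longleftrightarrow> (\<forall>i\<in>{1..n}. P i)"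
  using bij_betw_imp_surj_on[OF bij_betw_reflect, of n] by (metis (no_types, lifting) image_iff)

text \<open>Under reflection, \<open>x < m < y\<close> become the letters \<open>z > j > i\<close>,
  and the forbidden ranks say that they occur in the order \<open>j\<close>, \<open>z\<close>,
  \<open>i\<close>.\<close>

lemma canonical_edge_rank_iff:
  assumes w: "w permutes {1..n}" and k: "k \<le> n"
  shows "canonical (n - k) n (edge_rank n w) \<longleftrightarrow> stack_sort_perm n w \<in> weak_ideal n (w_circ k n)"
proof -
  let ?v = "inv w"
  have "canonical (n - k) n (edge_rank n w) \<longleftrightarrow>
      (\<forall>z\<in>{1..n}. \<forall>i\<in>{1..n}. \<forall>j\<in>{1..n}. \<not> (i < j \<and> j < z \<and> k < j \<and> ?v j < ?v z \<and> ?v z < ?v i))"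
    (is "_ \<longleftrightarrow> (\<forall>z\<in>_. \<forall>i\<in>_. \<forall>j\<in>_. ?Q z i j)")
  proof -
    have "canonical (n - k) n (edge_rank n w) \<longleftrightarrow>
        (\<forall>x\<in>{1..n}. \<forall>y\<in>{1..n}. \<forall>m\<in>{1..n}. ?Q (n + 1 - x) (n + 1 - y) (n + 1 - m))"
    proof -
      have "?Q (n + 1 - x) (n + 1 - y) (n + 1 - m) \<longleftrightarrow> \<not> (m \<le> n - k \<and> x < m \<and> m < y \<and>
          edge_rank n w m < edge_rank n w x \<and> edge_rank n w x < edge_rank n w y)"
        if "x \<in> {1..n}" "y \<in> {1..n}" "m \<in> {1..n}" for x y m
      proof -
        have "n + 1 - y < n + 1 - m \<longleftrightarrow> m < y" "n + 1 - m < n + 1 - x \<longleftrightarrow> x < m" "k < n + 1 - m \<longleftrightarrow> m \<le> n - k"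
          using that k by auto
        then show ?thesis unfolding edge_rank_def by blast
      qed
      \<comment> \<open>\<open>canonical\<close> only bounds \<open>m\<close> by the chain; its
        position between \<open>x\<close> and \<open>y\<close> gives the range in which reflection
        is a bijection.\<close>
      moreover have "m \<in> {1..n}" if "x \<in> {1..n}" "y \<in> {1..n}" "x < m" "m < y" for x y m :: nat
        using that by auto
      ultimately show ?thesis unfolding canonical_def by (meson atMost_iff)
    qed
    also have "\<dots> \<longleftrightarrow> (\<forall>z\<in>{1..n}. \<forall>i\<in>{1..n}. \<forall>j\<in>{1..n}. ?Q z i j)"
      unfolding ball_reflect[of n "\<lambda>j. ?Q _ _ j"] ball_reflect[of n "\<lambda>i. \<forall>j\<in>{1..n}. ?Q _ i j"]
        ball_reflect[of n "\<lambda>z. \<forall>i\<in>{1..n}. \<forall>j\<in>{1..n}. ?Q z i j"] ..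
    finally show ?thesis .
  qed
  then show ?thesis unfolding weak_ideal_w_circ_iff[OF w k] by blast
qed

lemma ascents_edge_rank_iff:
  assumes "e \<in> {1..n}" "f \<in> {1..n}"
  shows "(e, f) \<in> ascents n (edge_rank n w) \<longleftrightarrow> (n + 1 - f, n + 1 - e) \<in> Inversions n w"
  using assms by (auto simp: ascents_def Inversions_def edge_rank_def)

lemma weak_le_iff_ascents:
  "weak_le n w w' \<longleftrightarrow> ascents n (edge_rank n w) \<subseteq> ascents n (edge_rank n w')"
proof
  assume le: "weak_le n w w'"
  show "ascents n (edge_rank n w) \<subseteq> ascents n (edge_rank n w')"
  proof clarify
    fix e f assume "(e, f) \<in> ascents n (edge_rank n w)"
    moreover from this have "e \<in> {1..n}" "f \<in> {1..n}" by (auto simp: ascents_def)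
    ultimately show "(e, f) \<in> ascents n (edge_rank n w')"
      using le ascents_edge_rank_iff unfolding weak_le_def by blast
  qed
next
  assume le: "ascents n (edge_rank n w) \<subseteq> ascents n (edge_rank n w')"
  show "weak_le n w w'"
    unfolding weak_le_def
  proof clarify
    fix i j assume ij: "(i, j) \<in> Inversions n w"
    then have "i \<in> {1..n}" "j \<in> {1..n}" by (auto simp: Inversions_def)
    then have "n + 1 - j \<in> {1..n}" "n + 1 - i \<in> {1..n}" "n + 1 - (n + 1 - i) = i" "n + 1 - (n + 1 - j) = j"
      by auto
    then show "(i, j) \<in> Inversions n w'"
      using ij le ascents_edge_rank_iff[of "n + 1 - j" n "n + 1 - i"] by auto
  qed
qed

lemma exists_perm_edge_rank:
  assumes r: "bij_betw r {1..n} {1..n}"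
  obtains w where "w permutes {1..n}" "\<And>e. e \<in> {1..n} \<Longrightarrow> edge_rank n w e = r e"
proof -
  \<comment> \<open>The identity outside \<open>{1..n}\<close> is what \<open>permutes\<close>
    requires.\<close>
  define v where "v i = (if i \<in> {1..n} then r (n + 1 - i) else i)" for i
  have "bij_betw (r \<circ> (\<lambda>i. n + 1 - i)) {1..n} {1..n}" by (rule bij_betw_trans[OF bij_betw_reflect r])
  then have "bij_betw v {1..n} {1..n}" by (rule bij_betw_cong[THEN iffD1, rotated]) (simp add: v_def)
  then have v: "v permutes {1..n}" by (rule bij_imp_permutes) (auto simp: v_def)
  have "edge_rank n (inv v) e = r e" if "e \<in> {1..n}" for e
    using that by (auto simp: edge_rank_def permutes_inv_inv[OF v] v_def)
  then show ?thesis using that[OF permutes_inv[OF v]] by blast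
qed

text \<open>With equal ascent sets no removable ascent remains in \<open>ascents_chain_step\<close>,
  so the rankings agree.\<close>

lemma edge_rank_eq_imp_eq:
  assumes w: "w permutes {1..n}" "w' permutes {1..n}" and eq: "ascents n (edge_rank n w) = ascents n (edge_rank n w')"
  shows "w = w'"
proof -
  have "\<forall>e\<in>{1..n}. edge_rank n w e = edge_rank n w' e"
    using ascents_chain_step[OF bij_betw_edge_rank[OF w(1)] bij_betw_edge_rank[OF w(2)]] eq
    by (auto simp: ascents_def)
  then have "\<forall>i\<in>{1..n}. inv w i = inv w' i"
    unfolding edge_rank_def by (rule ball_reflect[THEN iffD1])
  then have "inv w = inv w'"
    using permutes_not_in[OF permutes_inv[OF w(1)]] permutes_not_in[OF permutes_inv[OF w(2)]] by (metis ext)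
  then show ?thesis using permutes_inv_inv w by metis
qed

theorem theorem1p6:
  fixes k n :: nat
  assumes "1 \<le> k" and "k \<le> n"
  shows "poset_isomorphic
           (MN (broom k n)) (MN_le (broom k n))
           {w. w permutes {1..n} \<and> stack_sort_perm n w \<in> weak_ideal n (w_circ k n)} (weak_le n)"
proof -
  let ?Q = "{w. w permutes {1..n} \<and> stack_sort_perm n w \<in> weak_ideal n (w_circ k n)}"
  define g where "g w = Nest (n - k) n (edge_rank n w)" for w
  have Q: "bij_betw (edge_rank n w) {1..n} {1..n}" "canonical (n - k) n (edge_rank n w)" "w permutes {1..n}"
    if "w \<in> ?Q" for w
    using that bij_betw_edge_rank canonical_edge_rank_iff[OF _ assms(2)] by auto
  have le: "MN_le (broom k n) (g w) (g w') \<longleftrightarrow> weak_le n w w'" if "w \<in> ?Q" "w' \<in> ?Q" for w w'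
    unfolding g_def weak_le_iff_ascents
    using MN_le_Nest[OF assms Q(1)[OF that(1)] Q(1)[OF that(2)]]
      MN_le_imp_ascents_subset[OF assms Q(1,2)[OF that(1)] Q(1,2)[OF that(2)]] by blast
  have "inj_on g ?Q"
  proof (rule inj_onI)
    fix w w' assume w: "w \<in> ?Q" "w' \<in> ?Q" "g w = g w'"
    then have "ascents n (edge_rank n w) = ascents n (edge_rank n w')"
      unfolding g_def using Nest_eq_imp_ascents_eq[OF bij_betw_imp_inj_on[OF Q(1)[OF w(1)]]
        bij_betw_imp_inj_on[OF Q(1)[OF w(2)]] Q(2)[OF w(1)] Q(2)[OF w(2)]] by blast
    then show "w = w'" by (rule edge_rank_eq_imp_eq[OF Q(3)[OF w(1)] Q(3)[OF w(2)]])
  qed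
  moreover have "g ` ?Q = MN (broom k n)"
  proof
    show "g ` ?Q \<subseteq> MN (broom k n)"
      unfolding MN_broom[OF assms] g_def using Q(1) by auto
    show "MN (broom k n) \<subseteq> g ` ?Q"
    proof
      fix N assume "N \<in> MN (broom k n)"
      then obtain r where r: "bij_betw r {1..n} {1..n}" "canonical (n - k) n r" "N = Nest (n - k) n r"
        unfolding MN_broom[OF assms] using exists_canonical[of _ n "n - k"] by (auto, metis)
      obtain w where w: "w permutes {1..n}" "\<And>e. e \<in> {1..n} \<Longrightarrow> edge_rank n w e = r e"
        using exists_perm_edge_rank[OF r(1)] by blast
      have "canonical (n - k) n (edge_rank n w)"
      proof -
        have "m \<in> {1..n}" if "x \<in> {1..n}" "y \<in> {1..n}" "x < m" "m < y" for x y m :: nat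
          using that by auto
        then show ?thesis using r(2) w(2) unfolding canonical_def by metis
      qed
      then have "w \<in> ?Q" using w(1) canonical_edge_rank_iff[OF w(1) assms(2)] by simp
      moreover have "N = g w" unfolding g_def r(3) using w(2) by (intro Nest_cong) simp
      ultimately show "N \<in> g ` ?Q" by blast
    qed
  qed
  ultimately have g: "bij_betw g ?Q (MN (broom k n))" by (simp add: bij_betw_def)
  show ?thesis
    unfolding poset_isomorphic_def
  proof (intro exI conjI ballI)
    \<comment> \<open>The map \<open>g\<close> sends permutations to nestings; the isomorphism asked
      for is its inverse.\<close>
    show "bij_betw (inv_into ?Q g) (MN (broom k n)) ?Q" by (rule bij_betw_inv_into[OF g])
    fix M N assume MN: "M \<in> MN (broom k n)" "N \<in> MN (broom k n)"
    have "inv_into ?Q g M \<in> ?Q" "inv_into ?Q g N \<in> ?Q"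
      using bij_betwE[OF bij_betw_inv_into[OF g]] MN by blast+
    from le[OF this] show "MN_le (broom k n) M N \<longleftrightarrow> weak_le n (inv_into ?Q g M) (inv_into ?Q g N)"
      using bij_betw_inv_into_right[OF g] MN by simp
  qed
qed

end
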